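(* Let $(\omega^1,\omega^2)$ be a bi-contact structure on a 3-manifold $M$ with invariant function $C$. If $dC\wedge\omega^1\wedge\omega^2=C_3\,\Omega\neq0$ (nowhere zero) but $dC_3\wedge\omega^3=0$ on $M$, then there is a manifold $\widetilde M$ containing $M$ as a submanifold such that $\widetilde M$ admits a symplectic quadratic.
   Context: A bi-contact structure on an orientable 3-manifold $M$ is a pair of contact 1-forms $(\omega^1,\omega^2)$ with $\ker\omega^1(p)\ne\ker\omega^2(p)$ for every $p$; it is normalized (1-adapted) so that $\omega^1\wedge d\omega^1=-\epsilon\,\omega^2\wedge d\omega^2=:\Omega$ for a sign $\epsilon=\pm1$. The function $C$ is defined by $\omega^1\wedge d\omega^2+\omega^2\wedge d\omega^1=2C\,\Omega$. The 1-form $\omega^3$ completes $\omega^1,\omega^2$ to a coframe with $\omega^1\wedge\omega^2\wedge\omega^3=\Omega$, and since $C_3\neq0$ it is adapted so that $dC=C_3\,\omega^3$. A symplectic quadratic on a 4-manifold is a pair of symplectic forms $\theta^1,\theta^2$ such that, for $\theta_a=a_1\theta^1+a_2\theta^2$, one has $\theta_a\wedge\theta_a=\mathcal{P}_C(a)\,\Omega$ for a volume form $\Omega$ on the 4-manifold and $\mathcal{P}_C(a)=a_1^2-\epsilon a_2^2+2Ca_1a_2$ with $C$ some function and $\epsilon=\pm1$; the coefficients $a=(a_1,a_2)$ are taken on the quadric $\mathcal{P}_C(a)=1$ (the volume forms of $\theta^1,\theta^2$ may have opposite orientations in the hyperbolic case). *)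

theory Defs
  imports "HOL-Analysis.Analysis"
begin

section \<open>Smooth functions on open subsets of Euclidean space\<close>

text \<open>Only used for open \<open>S\<close>. On a finite-dimensional domain, having continuous iterated
  directional derivatives up to order \<open>n\<close> is the usual notion of class \<open>C\<^sup>n\<close>.\<close>

primrec Ck_on :: "nat \<Rightarrow> 'a::euclidean_space set \<Rightarrow> ('a \<Rightarrow> 'b::real_normed_vector) \<Rightarrow> bool" where
  "Ck_on 0 S f \<longleftrightarrow> continuous_on S f"
| "Ck_on (Suc n) S f \<longleftrightarrow>
     (\<forall>x\<in>S. f differentiable (at x)) \<and> (\<forall>v. Ck_on n S (\<lambda>x. frechet_derivative f (at x) v))"

definition smooth_on :: "'a::euclidean_space set \<Rightarrow> ('a \<Rightarrow> 'b::real_normed_vector) \<Rightarrow> bool" where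
  "smooth_on S f \<longleftrightarrow> (\<forall>n. Ck_on n S f)"


section \<open>Smooth manifolds\<close>

text \<open>A manifold is a topological space \<open>X\<close> with a (not necessarily maximal) smooth atlas \<open>A\<close>;
  its dimension is that of the model space. A chart is a pair \<open>(U, \<phi>)\<close>; only the values of \<open>\<phi>\<close>
  on \<open>U\<close> matter.\<close>

type_synonym ('m, 'a) chart = "'m set \<times> ('m \<Rightarrow> 'a)"

definition chart_image :: "('m, 'a) chart \<Rightarrow> 'a set" where
  "chart_image c = snd c ` fst c"

definition chart_inv :: "('m, 'a) chart \<Rightarrow> 'a \<Rightarrow> 'm" where
  "chart_inv c = inv_into (fst c) (snd c)"

definition is_chart :: "'m topology \<Rightarrow> ('m, 'a::euclidean_space) chart \<Rightarrow> bool" where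
  "is_chart X c \<longleftrightarrow>
     openin X (fst c) \<and> open (chart_image c) \<and>
     homeomorphic_map (subtopology X (fst c)) (top_of_set (chart_image c)) (snd c)"

definition smooth_manifold :: "'m topology \<Rightarrow> ('m, 'a::euclidean_space) chart set \<Rightarrow> bool" where
  "smooth_manifold X A \<longleftrightarrow>
     Hausdorff_space X \<and> second_countable X \<and>
     (\<forall>c\<in>A. is_chart X c) \<and> (\<Union>c\<in>A. fst c) = topspace X \<and>
     (\<forall>c\<in>A. \<forall>d\<in>A. smooth_on (snd c ` (fst c \<inter> fst d)) (snd d \<circ> chart_inv c))"

definition smooth_map ::
  "'m topology \<Rightarrow> ('m, 'a::euclidean_space) chart set \<Rightarrow>
   'n topology \<Rightarrow> ('n, 'b::euclidean_space) chart set \<Rightarrow> ('m \<Rightarrow> 'n) \<Rightarrow> bool" where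
  "smooth_map X A Y B f \<longleftrightarrow>
     continuous_map X Y f \<and>
     (\<forall>c\<in>A. \<forall>d\<in>B. smooth_on (snd c ` {p \<in> fst c. f p \<in> fst d}) (snd d \<circ> f \<circ> chart_inv c))"

definition immersion ::
  "'m topology \<Rightarrow> ('m, 'a::euclidean_space) chart set \<Rightarrow>
   'n topology \<Rightarrow> ('n, 'b::euclidean_space) chart set \<Rightarrow> ('m \<Rightarrow> 'n) \<Rightarrow> bool" where
  "immersion X A Y B f \<longleftrightarrow>
     smooth_map X A Y B f \<and>
     (\<forall>c\<in>A. \<forall>d\<in>B. \<forall>p\<in>fst c. f p \<in> fst d \<longrightarrow>
        inj (frechet_derivative (snd d \<circ> f \<circ> chart_inv c) (at (snd c p))))"

text \<open>A smooth embedding of \<open>X\<close> into \<open>Y\<close> identifies \<open>X\<close> with a submanifold of \<open>Y\<close>.\<close>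

definition smooth_embedding ::
  "'m topology \<Rightarrow> ('m, 'a::euclidean_space) chart set \<Rightarrow>
   'n topology \<Rightarrow> ('n, 'b::euclidean_space) chart set \<Rightarrow> ('m \<Rightarrow> 'n) \<Rightarrow> bool" where
  "smooth_embedding X A Y B f \<longleftrightarrow> immersion X A Y B f \<and> embedding_map X Y f"

definition smooth_fun ::
  "('m, 'a::euclidean_space) chart set \<Rightarrow> ('m \<Rightarrow> real) \<Rightarrow> bool" where
  "smooth_fun A f \<longleftrightarrow> (\<forall>c\<in>A. smooth_on (chart_image c) (f \<circ> chart_inv c))"


section \<open>Alternating multilinear forms on a vector space\<close>

text \<open>A \<open>k\<close>-linear form takes its arguments as a sequence \<open>v\<close>, of which only
  \<open>v 0, \<dots>, v (k - 1)\<close> are used.\<close>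

definition alternating_form :: "nat \<Rightarrow> ((nat \<Rightarrow> 'a::real_vector) \<Rightarrow> real) \<Rightarrow> bool" where
  "alternating_form k \<alpha> \<longleftrightarrow>
     (\<forall>v w. (\<forall>i<k. v i = w i) \<longrightarrow> \<alpha> v = \<alpha> w) \<and>
     (\<forall>i<k. \<forall>v. linear (\<lambda>u. \<alpha> (v(i := u)))) \<and>
     (\<forall>i<k. \<forall>j<k. \<forall>v. i \<noteq> j \<and> v i = v j \<longrightarrow> \<alpha> v = 0)"

text \<open>Normalised so that \<open>\<alpha> \<and> \<beta>\<close> takes \<open>u, v\<close> to \<open>\<alpha> u * \<beta> v - \<alpha> v * \<beta> u\<close> for
  one-forms.\<close>

definition alt_wedge ::
  "nat \<Rightarrow> nat \<Rightarrow> ((nat \<Rightarrow> 'a) \<Rightarrow> real) \<Rightarrow> ((nat \<Rightarrow> 'a) \<Rightarrow> real) \<Rightarrow> (nat \<Rightarrow> 'a) \<Rightarrow> real" where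
  "alt_wedge k l \<alpha> \<beta> v =
     (\<Sum>\<sigma> | \<sigma> permutes {..<k + l}.
        of_int (sign \<sigma>) * \<alpha> (\<lambda>i. v (\<sigma> i)) * \<beta> (\<lambda>i. v (\<sigma> (k + i)))) / (fact k * fact l)"


section \<open>Differential forms on a manifold\<close>

text \<open>A form is given by its local representatives: \<open>\<omega> c x\<close> is the form on the model space
  at the point with coordinates \<open>x\<close> in the chart \<open>c\<close>. The last condition of
  \<open>differential_form\<close> says that the representatives are pulled back to each other by the
  transition maps.\<close>

type_synonym ('m, 'a) form = "('m, 'a) chart \<Rightarrow> 'a \<Rightarrow> (nat \<Rightarrow> 'a) \<Rightarrow> real"

definition differential_form ::
  "nat \<Rightarrow> ('m, 'a::euclidean_space) chart set \<Rightarrow> ('m, 'a) form \<Rightarrow> bool" where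
  "differential_form k A \<omega> \<longleftrightarrow>
     (\<forall>c\<in>A. \<forall>x\<in>chart_image c. alternating_form k (\<omega> c x)) \<and>
     (\<forall>c\<in>A. \<forall>v. smooth_on (chart_image c) (\<lambda>x. \<omega> c x v)) \<and>
     (\<forall>c\<in>A. \<forall>d\<in>A. \<forall>p\<in>fst c \<inter> fst d. \<forall>v.
        \<omega> c (snd c p) v =
        \<omega> d (snd d p) (\<lambda>i. frechet_derivative (snd d \<circ> chart_inv c) (at (snd c p)) (v i)))"

definition form_eq :: "('m, 'a) chart set \<Rightarrow> ('m, 'a) form \<Rightarrow> ('m, 'a) form \<Rightarrow> bool" where
  "form_eq A \<alpha> \<beta> \<longleftrightarrow> (\<forall>c\<in>A. \<forall>x\<in>chart_image c. \<forall>v. \<alpha> c x v = \<beta> c x v)"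

definition nowhere_zero :: "('m, 'a) chart set \<Rightarrow> ('m, 'a) form \<Rightarrow> bool" where
  "nowhere_zero A \<alpha> \<longleftrightarrow> (\<forall>c\<in>A. \<forall>x\<in>chart_image c. \<exists>v. \<alpha> c x v \<noteq> 0)"

definition form_zero :: "('m, 'a) form" where
  "form_zero = (\<lambda>c x v. 0)"

definition form_add :: "('m, 'a) form \<Rightarrow> ('m, 'a) form \<Rightarrow> ('m, 'a) form" where
  "form_add \<alpha> \<beta> = (\<lambda>c x v. \<alpha> c x v + \<beta> c x v)"

definition form_scale :: "('m \<Rightarrow> real) \<Rightarrow> ('m, 'a) form \<Rightarrow> ('m, 'a) form" where
  "form_scale f \<alpha> = (\<lambda>c x v. f (chart_inv c x) * \<alpha> c x v)"

definition zero_form :: "('m \<Rightarrow> real) \<Rightarrow> ('m, 'a) form" where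
  "zero_form f = (\<lambda>c x v. f (chart_inv c x))"

definition wedge :: "nat \<Rightarrow> nat \<Rightarrow> ('m, 'a) form \<Rightarrow> ('m, 'a) form \<Rightarrow> ('m, 'a) form" where
  "wedge k l \<alpha> \<beta> = (\<lambda>c x. alt_wedge k l (\<alpha> c x) (\<beta> c x))"

text \<open>\<open>ext_deriv k \<alpha>\<close> at \<open>v 0, \<dots>, v k\<close> is the alternating sum over \<open>i\<close> of the derivative,
  in direction \<open>v i\<close>, of the \<open>k\<close>-form \<open>\<alpha>\<close> at the remaining vectors.\<close>

definition ext_deriv :: "nat \<Rightarrow> ('m, 'a::euclidean_space) form \<Rightarrow> ('m, 'a) form" where
  "ext_deriv k \<alpha> = (\<lambda>c x v. \<Sum>i\<le>k. (- 1) ^ i *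
     frechet_derivative (\<lambda>y. \<alpha> c y (\<lambda>j. v (if j < i then j else Suc j))) (at x) (v i))"

definition differential :: "('m \<Rightarrow> real) \<Rightarrow> ('m, 'a::euclidean_space) form" where
  "differential f = ext_deriv 0 (zero_form f)"

definition volume_form :: "('m, 'a::euclidean_space) chart set \<Rightarrow> ('m, 'a) form \<Rightarrow> bool" where
  "volume_form A \<Omega> \<longleftrightarrow> differential_form DIM('a) A \<Omega> \<and> nowhere_zero A \<Omega>"

definition orientable :: "('m, 'a::euclidean_space) chart set \<Rightarrow> bool" where
  "orientable A \<longleftrightarrow> (\<exists>\<Omega>. volume_form A \<Omega>)"


section \<open>Contact forms and bi-contact structures on 3-manifolds\<close>

definition contact_form :: "('m, real^3) chart set \<Rightarrow> ('m, real^3) form \<Rightarrow> bool" where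
  "contact_form A \<omega> \<longleftrightarrow>
     differential_form 1 A \<omega> \<and> nowhere_zero A (wedge 1 2 \<omega> (ext_deriv 1 \<omega>))"

definition form_kernel :: "('m, 'a) form \<Rightarrow> ('m, 'a) chart \<Rightarrow> 'a \<Rightarrow> 'a set" where
  "form_kernel \<omega> c x = {u. \<omega> c x (\<lambda>_. u) = 0}"

definition bi_contact ::
  "('m, real^3) chart set \<Rightarrow> ('m, real^3) form \<Rightarrow> ('m, real^3) form \<Rightarrow> bool" where
  "bi_contact A \<omega>1 \<omega>2 \<longleftrightarrow>
     contact_form A \<omega>1 \<and> contact_form A \<omega>2 \<and>
     (\<forall>c\<in>A. \<forall>x\<in>chart_image c. form_kernel \<omega>1 c x \<noteq> form_kernel \<omega>2 c x)"

definition normalized_bi_contact ::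
  "('m, real^3) chart set \<Rightarrow> real \<Rightarrow> ('m, real^3) form \<Rightarrow>
   ('m, real^3) form \<Rightarrow> ('m, real^3) form \<Rightarrow> bool" where
  "normalized_bi_contact A \<epsilon> \<omega>1 \<omega>2 \<Omega> \<longleftrightarrow>
     bi_contact A \<omega>1 \<omega>2 \<and> \<epsilon> \<in> {1, - 1} \<and>
     form_eq A \<Omega> (wedge 1 2 \<omega>1 (ext_deriv 1 \<omega>1)) \<and>
     form_eq A \<Omega> (form_scale (\<lambda>_. - \<epsilon>) (wedge 1 2 \<omega>2 (ext_deriv 1 \<omega>2)))"

definition invariant_function ::
  "('m, real^3) chart set \<Rightarrow> ('m, real^3) form \<Rightarrow> ('m, real^3) form \<Rightarrow>
   ('m, real^3) form \<Rightarrow> ('m \<Rightarrow> real) \<Rightarrow> bool" where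
  "invariant_function A \<omega>1 \<omega>2 \<Omega> C \<longleftrightarrow>
     smooth_fun A C \<and>
     form_eq A
       (form_add (wedge 1 2 \<omega>1 (ext_deriv 1 \<omega>2)) (wedge 1 2 \<omega>2 (ext_deriv 1 \<omega>1)))
       (form_scale (\<lambda>p. 2 * C p) \<Omega>)"


section \<open>Symplectic quadratics on 4-manifolds\<close>

definition symplectic_form ::
  "('m, 'a::euclidean_space) chart set \<Rightarrow> ('m, 'a) form \<Rightarrow> bool" where
  "symplectic_form A \<theta> \<longleftrightarrow>
     differential_form 2 A \<theta> \<and> form_eq A (ext_deriv 2 \<theta>) form_zero \<and>
     (\<forall>c\<in>A. \<forall>x\<in>chart_image c. \<forall>v. v 0 \<noteq> 0 \<longrightarrow> (\<exists>u. \<theta> c x (v(1 := u)) \<noteq> 0))"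

definition quadratic_poly :: "real \<Rightarrow> real \<Rightarrow> real \<Rightarrow> real \<Rightarrow> real" where
  "quadratic_poly \<epsilon> C a1 a2 = a1\<^sup>2 - \<epsilon> * a2\<^sup>2 + 2 * C * a1 * a2"

text \<open>The coefficients \<open>a1, a2\<close> are functions, since for non-constant \<open>C\<close> the quadric
  \<open>quadratic_poly \<epsilon> (C p) (a1 p) (a2 p) = 1\<close> varies with the point \<open>p\<close>. Requiring the identity
  for all coefficients rather than only on the quadric is no restriction, as a quadratic form
  is determined by its level set of value 1 when that is nonempty, which it is here at
  \<open>a1 = 1, a2 = 0\<close>.\<close>

definition symplectic_quadratic ::
  "('m, real^4) chart set \<Rightarrow> real \<Rightarrow> ('m \<Rightarrow> real) \<Rightarrow> ('m, real^4) form \<Rightarrow>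
   ('m, real^4) form \<Rightarrow> ('m, real^4) form \<Rightarrow> bool" where
  "symplectic_quadratic A \<epsilon> C \<Omega> \<theta>1 \<theta>2 \<longleftrightarrow>
     \<epsilon> \<in> {1, - 1} \<and> smooth_fun A C \<and> volume_form A \<Omega> \<and>
     symplectic_form A \<theta>1 \<and> symplectic_form A \<theta>2 \<and>
     (\<forall>a1 a2. let \<theta> = form_add (form_scale a1 \<theta>1) (form_scale a2 \<theta>2) in
        form_eq A (wedge 2 2 \<theta> \<theta>)
          (form_scale (\<lambda>p. quadratic_poly \<epsilon> (C p) (a1 p) (a2 p)) \<Omega>))"

definition admits_symplectic_quadratic :: "('m, real^4) chart set \<Rightarrow> bool" where
  "admits_symplectic_quadratic A \<longleftrightarrow> (\<exists>\<epsilon> C \<Omega> \<theta>1 \<theta>2. symplectic_quadratic A \<epsilon> C \<Omega> \<theta>1 \<theta>2)"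

end

theory Submission
  imports Defs
begin

text \<open>On \<open>M \<times> \<real>\<close> with coordinate \<open>t\<close> on the line, take the symplectizations
  \<open>\<theta>\<^sub>i = d(e\<^sup>t \<omega>\<^sub>i) = e\<^sup>t (dt \<and> \<omega>\<^sub>i + d\<omega>\<^sub>i)\<close>. A four-form on \<open>M\<close> vanishes,
  so \<open>\<theta>\<^sub>i \<and> \<theta>\<^sub>j = e\<^sup>2\<^sup>t dt \<and> (\<omega>\<^sub>i \<and> d\<omega>\<^sub>j + \<omega>\<^sub>j \<and> d\<omega>\<^sub>i)\<close>.
  By the normalization of the bi-contact structure and the definition of \<open>C\<close>, the square of
  \<open>a\<^sub>1 \<theta>\<^sub>1 + a\<^sub>2 \<theta>\<^sub>2\<close> is therefore the quadratic polynomial in \<open>a\<^sub>1, a\<^sub>2\<close> with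
  parameter \<open>C\<close> times the volume form \<open>\<theta>\<^sub>1 \<and> \<theta>\<^sub>1 = 2 e\<^sup>2\<^sup>t dt \<and> \<Omega>\<close>.\<close>

section \<open>Calculus\<close>


lemma frechet_eq: "(f has_derivative f') (at x) \<Longrightarrow> frechet_derivative f (at x) = f'"
  using frechet_derivative_at by metis

lemma frechet_has:
  "f differentiable (at x) \<Longrightarrow> (f has_derivative frechet_derivative f (at x)) (at x)"
  using frechet_derivative_works by blast

lemma frechet_derivative_cong_open:
  assumes "open S" "x \<in> S" "\<And>y. y \<in> S \<Longrightarrow> f y = g y"
  shows "frechet_derivative f (at x) = frechet_derivative g (at x)"
proof -
  \<comment> \<open>\<open>frechet_derivative\<close> chooses among all candidate derivatives, so
    equal sets of candidates give equal values, whether or not the functions are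
    differentiable.\<close>
  have "(f has_derivative D) (at x) \<longleftrightarrow> (g has_derivative D) (at x)" for D
    using has_derivative_transform_within_open[of f D x UNIV S g]
      has_derivative_transform_within_open[of g D x UNIV S f] assms by auto
  then show ?thesis by (simp add: frechet_derivative_def)
qed

lemma differentiable_cong_open:
  assumes "open S" "x \<in> S" "\<And>y. y \<in> S \<Longrightarrow> f y = g y" "f differentiable (at x)"
  shows "g differentiable (at x)"
  using assms has_derivative_transform_within_open[of f _ x UNIV S g]
  unfolding differentiable_def by blast

text \<open>Allows a derivative to be replaced by a formula that is valid on \<open>S\<close> only.
  Openness carries the induction: agreement on a neighbourhood passes to the derivatives.\<close>

lemma Ck_on_cong:
  assumes "open S" "\<And>y. y \<in> S \<Longrightarrow> f y = g y" "Ck_on n S f"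
  shows "Ck_on n S g"
  using assms(2,3)
proof (induction n arbitrary: f g)
  case 0
  then show ?case using continuous_on_cong by fastforce
next
  case (Suc n)
  have "Ck_on n S (\<lambda>x. frechet_derivative g (at x) v)" for v
  proof (rule Suc.IH)
    show "Ck_on n S (\<lambda>x. frechet_derivative f (at x) v)" using Suc.prems by simp
    show "frechet_derivative f (at y) v = frechet_derivative g (at y) v" if "y \<in> S" for y
      using frechet_derivative_cong_open[OF assms(1) that Suc.prems(1)] by simp
  qed
  moreover have "g differentiable (at x)" if "x \<in> S" for x
    using differentiable_cong_open[OF assms(1) that Suc.prems(1)] Suc.prems(2) that by simp
  ultimately show ?case by simp
qed

lemma Ck_on_Suc_lower: "Ck_on (Suc n) S f \<Longrightarrow> Ck_on n S f"
proof (induction n arbitrary: f)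
  case 0
  then show ?case
    by (auto intro!: differentiable_imp_continuous_on differentiable_at_imp_differentiable_on)
qed auto

lemma Ck_on_const: "Ck_on n S (\<lambda>x. c)"
  by (induction n arbitrary: c) auto

lemma Ck_on_add:
  assumes "open S" "Ck_on n S f" "Ck_on n S g"
  shows "Ck_on n S (\<lambda>x. f x + g x)"
  using assms(2,3)
proof (induction n arbitrary: f g)
  case 0
  then show ?case by (simp add: continuous_on_add)
next
  case (Suc n)
  have "Ck_on n S (\<lambda>x. frechet_derivative (\<lambda>x. f x + g x) (at x) v)" for v
  proof (rule Ck_on_cong[OF assms(1)])
    show "Ck_on n S (\<lambda>x. frechet_derivative f (at x) v + frechet_derivative g (at x) v)"
      using Suc by auto
    show "frechet_derivative f (at y) v + frechet_derivative g (at y) v =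
      frechet_derivative (\<lambda>x. f x + g x) (at y) v" if "y \<in> S" for y
      using Suc.prems that
      by (subst frechet_eq[OF has_derivative_add[OF frechet_has frechet_has]]) auto
  qed
  then show ?case using Suc.prems by (auto intro: differentiable_add)
qed

lemma Ck_on_linear_image:
  assumes "open S" "bounded_linear L" "Ck_on n S f"
  shows "Ck_on n S (\<lambda>x. L (f x))"
  using assms(3)
proof (induction n arbitrary: f)
  case 0
  then show ?case using assms(2) by (simp add: bounded_linear.continuous_on)
next
  case (Suc n)
  have D: "((\<lambda>x. L (f x)) has_derivative (\<lambda>v. L (frechet_derivative f (at x) v))) (at x)"
    if "x \<in> S" for x
    using Suc.prems that bounded_linear.has_derivative[OF assms(2) frechet_has] by auto
  have "Ck_on n S (\<lambda>x. frechet_derivative (\<lambda>x. L (f x)) (at x) v)" for v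
    by (rule Ck_on_cong[OF assms(1) _ Suc.IH]) (use Suc.prems in \<open>auto simp: frechet_eq[OF D]\<close>)
  then show ?case using D by (auto intro: differentiableI)
qed

text \<open>For a linear inner map the derivative in direction \<open>v\<close> is again a
  composition with \<open>L\<close>, namely of the derivative of \<open>f\<close> in the fixed
  direction \<open>L v\<close>. The induction thus closes without a chain rule for general smooth
  maps; the intended \<open>L\<close> is the projection off the line.\<close>

lemma Ck_on_linear_compose:
  assumes "open T" "bounded_linear L" "L ` T \<subseteq> S" "Ck_on n S f"
  shows "Ck_on n T (\<lambda>x. f (L x))"
  using assms(4)
proof (induction n arbitrary: f)
  case 0
  then have "continuous_on S f" by simp
  then show ?case
    using continuous_on_compose2[OF _ linear_continuous_on[OF assms(2)] assms(3)] by simp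
next
  case (Suc n)
  have D: "((\<lambda>x. f (L x)) has_derivative (\<lambda>v. frechet_derivative f (at (L x)) (L v))) (at x)"
    if "x \<in> T" for x
  proof -
    have "(f has_derivative frechet_derivative f (at (L x))) (at (L x))"
      using Suc.prems that assms(3) by (intro frechet_has) auto
    moreover have "(L has_derivative L) (at x)"
      using assms(2) by (rule bounded_linear_imp_has_derivative)
    ultimately show ?thesis using has_derivative_compose by fastforce
  qed
  have "Ck_on n T (\<lambda>x. frechet_derivative (\<lambda>x. f (L x)) (at x) v)" for v
    by (rule Ck_on_cong[OF assms(1) _ Suc.IH[of "\<lambda>x. frechet_derivative f (at x) (L v)"]])
      (use Suc.prems in \<open>auto simp: frechet_eq[OF D]\<close>)
  then show ?case using D by (auto intro: differentiableI)
qed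

lemma Ck_on_mult:
  fixes f g :: "'a::euclidean_space \<Rightarrow> real"
  assumes "open S" "Ck_on n S f" "Ck_on n S g"
  shows "Ck_on n S (\<lambda>x. f x * g x)"
  using assms(2,3)
proof (induction n arbitrary: f g)
  case 0
  then show ?case by (simp add: continuous_on_mult)
next
  case (Suc n)
  have D: "((\<lambda>x. f x * g x) has_derivative
      (\<lambda>v. f x * frechet_derivative g (at x) v + frechet_derivative f (at x) v * g x)) (at x)"
    if "x \<in> S" for x
    using Suc.prems that by (intro has_derivative_mult frechet_has) auto
  have "Ck_on n S (\<lambda>x. frechet_derivative (\<lambda>x. f x * g x) (at x) v)" for v
  proof (rule Ck_on_cong[OF assms(1)])
    \<comment> \<open>The product rule pairs undifferentiated factors of class n + 1 with
      derivatives of class n, so the former are lowered by one order.\<close>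
    show "Ck_on n S (\<lambda>x. f x * frechet_derivative g (at x) v + frechet_derivative f (at x) v * g x)"
      using Suc Ck_on_Suc_lower[of n S f] Ck_on_Suc_lower[of n S g]
      by (intro Ck_on_add[OF assms(1)] Suc.IH) auto
  qed (simp add: frechet_eq[OF D])
  then show ?case using D by (auto intro: differentiableI)
qed

lemma Ck_on_linear: "open S \<Longrightarrow> bounded_linear L \<Longrightarrow> Ck_on n S L"
proof (induction n)
  case 0
  then show ?case using linear_continuous_on by auto
next
  case (Suc n)
  have D: "(L has_derivative L) (at x)" for x
    using Suc.prems by (simp add: bounded_linear_imp_has_derivative)
  show ?case using frechet_eq[OF D] D by (auto simp: differentiable_def Ck_on_const)
qed

text \<open>Each directional derivative is a constant times the function itself, so one order of
  smoothness yields the next.\<close>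

lemma Ck_on_exp_linear:
  fixes l :: "'a::euclidean_space \<Rightarrow> real"
  assumes "open S" "bounded_linear l"
  shows "Ck_on n S (\<lambda>x. exp (l x))"
proof (induction n)
  case 0
  then show ?case using assms by (simp add: continuous_on_exp linear_continuous_on)
next
  case (Suc n)
  have D: "((\<lambda>x. exp (l x)) has_derivative (\<lambda>v. l v * exp (l x))) (at x)" for x
    using has_derivative_exp[OF bounded_linear_imp_has_derivative[OF assms(2)]] by (simp add: mult.commute)
  have "Ck_on n S (\<lambda>x. l v * exp (l x))" for v
    by (rule Ck_on_mult[OF assms(1) Ck_on_const Suc])
  then show ?case using D by (auto simp: frechet_eq[OF D] intro: differentiableI)
qed

lemma smooth_on_frechet:
  assumes "smooth_on S f"
  shows "smooth_on S (\<lambda>x. frechet_derivative f (at x) v)"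
  using assms Ck_on.simps(2)[of _ S f] unfolding smooth_on_def by blast

lemma smooth_on_differentiable: "smooth_on S f \<Longrightarrow> x \<in> S \<Longrightarrow> f differentiable (at x)"
  using Ck_on.simps(2)[of 0 S f] unfolding smooth_on_def by blast

lemma smooth_on_continuous: "smooth_on S f \<Longrightarrow> continuous_on S f"
  using Ck_on.simps(1)[of S f] unfolding smooth_on_def by blast

lemma smooth_on_cong:
  "open S \<Longrightarrow> (\<And>y. y \<in> S \<Longrightarrow> f y = g y) \<Longrightarrow> smooth_on S f \<Longrightarrow> smooth_on S g"
  unfolding smooth_on_def using Ck_on_cong by blast

lemma smooth_on_diff:
  assumes "open S" "smooth_on S f" "smooth_on S g"
  shows "smooth_on S (\<lambda>x. f x - g x)"
  using assms Ck_on_add[of S _ f "\<lambda>x. - g x"]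
    Ck_on_linear_image[OF assms(1) bounded_linear_minus[OF bounded_linear_ident], of _ g]
  unfolding smooth_on_def by simp

text \<open>The second difference over the parallelogram spanned by \<open>h u\<close> and
  \<open>h v\<close> is the increment of \<open>\<phi>\<close> from 0 to \<open>h\<close>. The mean
  value theorem along \<open>u\<close>, and then along \<open>v\<close>, produces the mixed
  derivative at an interior point. The left side is symmetric in \<open>u\<close> and
  \<open>v\<close>, which is what the symmetry of second derivatives exploits.\<close>

lemma second_difference_mean_value:
  fixes f :: "'a::real_normed_vector \<Rightarrow> real"
  assumes "0 < h"
    and in_S: "\<And>s t. 0 \<le> s \<Longrightarrow> s \<le> h \<Longrightarrow> 0 \<le> t \<Longrightarrow> t \<le> h \<Longrightarrow> x + s *\<^sub>R u + t *\<^sub>R v \<in> S"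
    and f: "\<And>y. y \<in> S \<Longrightarrow> f differentiable (at y)"
    and fu: "\<And>y. y \<in> S \<Longrightarrow> (\<lambda>z. frechet_derivative f (at z) u) differentiable (at y)"
  obtains s t where "0 < s" "s < h" "0 < t" "t < h"
    "f (x + h *\<^sub>R u + h *\<^sub>R v) - f (x + h *\<^sub>R u) - f (x + h *\<^sub>R v) + f x =
      h\<^sup>2 * frechet_derivative (\<lambda>z. frechet_derivative f (at z) u) (at (x + s *\<^sub>R u + t *\<^sub>R v)) v"
proof -
  define fu' where "fu' = (\<lambda>z. frechet_derivative f (at z) u)"
  define \<phi> where "\<phi> s = f (x + s *\<^sub>R u + h *\<^sub>R v) - f (x + s *\<^sub>R u)" for s
  have line: "((\<lambda>s. g (a + s *\<^sub>R w)) has_real_derivative frechet_derivative g (at (a + s *\<^sub>R w)) w) (at s)"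
    if "g differentiable (at (a + s *\<^sub>R w))" for g :: "'a \<Rightarrow> real" and a w s
  proof -
    have "((\<lambda>s. a + s *\<^sub>R w) has_derivative (\<lambda>r. r *\<^sub>R w)) (at s)"
      by (auto intro!: derivative_eq_intros)
    from has_derivative_compose[OF this frechet_has[OF that]]
    have "((\<lambda>s. g (a + s *\<^sub>R w)) has_derivative
        (\<lambda>r. frechet_derivative g (at (a + s *\<^sub>R w)) (r *\<^sub>R w))) (at s)" .
    moreover have "(\<lambda>r. frechet_derivative g (at (a + s *\<^sub>R w)) (r *\<^sub>R w)) =
        (*) (frechet_derivative g (at (a + s *\<^sub>R w)) w)"
      using linear_frechet_derivative[OF that] by (auto simp: linear_scale)
    ultimately show ?thesis by (simp add: has_field_derivative_def)
  qed
  have d1: "(\<phi> has_real_derivative (fu' (x + s *\<^sub>R u + h *\<^sub>R v) - fu' (x + s *\<^sub>R u))) (at s)"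
    if "0 \<le> s" "s \<le> h" for s
  proof -
    have "f differentiable (at (x + h *\<^sub>R v + s *\<^sub>R u))" "f differentiable (at (x + s *\<^sub>R u))"
      using f in_S[OF that, of h] in_S[OF that, of 0] assms(1) by (auto simp: add_ac)
    then show ?thesis unfolding \<phi>_def fu'_def
      using DERIV_diff[OF line[of f "x + h *\<^sub>R v" s u] line[of f x s u]] by (simp add: add_ac)
  qed
  obtain s where s: "0 < s" "s < h"
      "\<phi> h - \<phi> 0 = (h - 0) * (fu' (x + s *\<^sub>R u + h *\<^sub>R v) - fu' (x + s *\<^sub>R u))"
    using MVT2[OF assms(1) d1] by blast
  have d2: "((\<lambda>t. fu' (x + s *\<^sub>R u + t *\<^sub>R v)) has_real_derivative
       frechet_derivative fu' (at (x + s *\<^sub>R u + t *\<^sub>R v)) v) (at t)"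
    if "0 \<le> t" "t \<le> h" for t
    using s that by (intro line) (auto simp: fu'_def intro!: fu in_S)
  obtain t where t: "0 < t" "t < h"
    "fu' (x + s *\<^sub>R u + h *\<^sub>R v) - fu' (x + s *\<^sub>R u + 0 *\<^sub>R v) =
       (h - 0) * frechet_derivative fu' (at (x + s *\<^sub>R u + t *\<^sub>R v)) v"
    using MVT2[OF assms(1) d2] by blast
  show thesis
  proof (rule that[OF s(1,2) t(1,2)])
    show "f (x + h *\<^sub>R u + h *\<^sub>R v) - f (x + h *\<^sub>R u) - f (x + h *\<^sub>R v) + f x =
      h\<^sup>2 * frechet_derivative (\<lambda>z. frechet_derivative f (at z) u) (at (x + s *\<^sub>R u + t *\<^sub>R v)) v"
      using s(3) t(3) by (simp add: \<phi>_def fu'_def power2_eq_square)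
  qed
qed

text \<open>Were the two mixed derivatives different at \<open>x\<close>, continuity would keep them
  apart near \<open>x\<close>; but at two suitable nearby points both equal the same second
  difference divided by \<open>h\<^sup>2\<close>.\<close>

lemma second_derivative_symmetric_real:
  fixes f :: "'a::euclidean_space \<Rightarrow> real"
  assumes "open S" "x \<in> S" "smooth_on S f"
  shows "frechet_derivative (\<lambda>y. frechet_derivative f (at y) u) (at x) v =
         frechet_derivative (\<lambda>y. frechet_derivative f (at y) v) (at x) u"
proof (rule ccontr)
  define F where "F u v y = frechet_derivative (\<lambda>y. frechet_derivative f (at y) u) (at y) v" for u v y
  assume "\<not> ?thesis"
  then have ne: "F u v x \<noteq> F v u x" by (simp add: F_def)
  \<comment> \<open>Half the distance, so that the \<open>e\<close>-balls around the two values are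
    disjoint.\<close>
  define e where "e = dist (F u v x) (F v u x) / 2"
  have e: "0 < e" using ne by (simp add: e_def)
  have cont: "isCont (F u v) x" "isCont (F v u) x"
    using smooth_on_continuous[OF smooth_on_frechet[OF smooth_on_frechet[OF assms(3)]]] assms(1,2)
    unfolding F_def by (simp_all add: continuous_on_eq_continuous_at)
  obtain d1 where d1: "0 < d1" "\<And>y. dist y x < d1 \<Longrightarrow> dist (F u v y) (F u v x) < e"
    using cont(1) e unfolding continuous_at_eps_delta by meson
  obtain d2 where d2: "0 < d2" "\<And>y. dist y x < d2 \<Longrightarrow> dist (F v u y) (F v u x) < e"
    using cont(2) e unfolding continuous_at_eps_delta by meson
  obtain r where r: "0 < r" "ball x r \<subseteq> S"
    using openE[OF assms(1,2)] by blast
  define R where "R = min r (min d1 d2)"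
  have R: "0 < R" using r d1 d2 by (simp add: R_def)
  \<comment> \<open>Small enough for the whole parallelogram to stay within distance
    \<open>R\<close> of \<open>x\<close>; the summand 1 keeps the denominator positive when
    \<open>u\<close> and \<open>v\<close> are both zero.\<close>
  define h where "h = R / (2 * (norm u + norm v + 1))"
  have pos: "0 < norm u + norm v + 1" by (simp add: add_nonneg_pos)
  have h: "0 < h" using R pos by (simp add: h_def)
  \<comment> \<open>The condition on the norms lets one statement serve both orders of the two
    directions.\<close>
  have near: "dist (x + s *\<^sub>R a + t *\<^sub>R b) x < R"
    if "0 \<le> s" "s \<le> h" "0 \<le> t" "t \<le> h" "norm a + norm b = norm u + norm v" for s t a b
  proof -
    have "dist (x + s *\<^sub>R a + t *\<^sub>R b) x \<le> s * norm a + t * norm b"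
      using norm_triangle_ineq[of "s *\<^sub>R a" "t *\<^sub>R b"] that by (simp add: dist_norm algebra_simps)
    also have "\<dots> \<le> h * norm a + h * norm b"
      using that by (intro add_mono mult_right_mono) auto
    also have "\<dots> = h * (norm u + norm v)" using that(5) by (simp flip: distrib_left)
    also have "\<dots> < h * (2 * (norm u + norm v + 1))"
      using h pos by (intro mult_strict_left_mono) auto
    also have "\<dots> = R" using pos by (simp add: h_def)
    finally show ?thesis .
  qed
  have inS: "x + s *\<^sub>R a + t *\<^sub>R b \<in> S"
    if "0 \<le> s" "s \<le> h" "0 \<le> t" "t \<le> h" "norm a + norm b = norm u + norm v" for s t a b
    using near[OF that] r(2) unfolding R_def by (auto simp: subset_eq dist_commute)
  have dfs: "f differentiable (at y)" "(\<lambda>z. frechet_derivative f (at z) w) differentiable (at y)"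
    if "y \<in> S" for y w
    using smooth_on_differentiable[OF assms(3) that]
      smooth_on_differentiable[OF smooth_on_frechet[OF assms(3)] that] by auto
  obtain s t where 1: "0 < s" "s < h" "0 < t" "t < h"
    "f (x + h *\<^sub>R u + h *\<^sub>R v) - f (x + h *\<^sub>R u) - f (x + h *\<^sub>R v) + f x =
      h\<^sup>2 * F u v (x + s *\<^sub>R u + t *\<^sub>R v)"
    unfolding F_def
    by (rule second_difference_mean_value[of h x u v S f]) (use h inS dfs in auto)
  obtain s' t' where 2: "0 < s'" "s' < h" "0 < t'" "t' < h"
    "f (x + h *\<^sub>R v + h *\<^sub>R u) - f (x + h *\<^sub>R v) - f (x + h *\<^sub>R u) + f x =
      h\<^sup>2 * F v u (x + s' *\<^sub>R v + t' *\<^sub>R u)"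
    unfolding F_def
    by (rule second_difference_mean_value[of h x v u S f]) (use h inS dfs in auto)
  have "h\<^sup>2 * F u v (x + s *\<^sub>R u + t *\<^sub>R v) = h\<^sup>2 * F v u (x + s' *\<^sub>R v + t' *\<^sub>R u)"
    using 1(5) 2(5) by (simp add: algebra_simps)
  then have eq: "F u v (x + s *\<^sub>R u + t *\<^sub>R v) = F v u (x + s' *\<^sub>R v + t' *\<^sub>R u)"
    using h by simp
  have "dist (F u v (x + s *\<^sub>R u + t *\<^sub>R v)) (F u v x) < e"
    using near[of s t u v] 1 by (intro d1(2)) (auto simp: R_def)
  moreover have "dist (F v u (x + s' *\<^sub>R v + t' *\<^sub>R u)) (F v u x) < e"
    using near[of s' t' v u] 2 by (intro d2(2)) (auto simp: R_def)
  ultimately have "dist (F u v x) (F v u x) < 2 * e"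
    unfolding eq 
    using dist_triangle3[of "F u v x" "F v u x" "F v u (x + s' *\<^sub>R v + t' *\<^sub>R u)"] by linarith
  then show False by (simp add: e_def)
qed

text \<open>Taking the inner product with a basis vector commutes with differentiation, which
  reduces the claim to real functions. The vector-valued version is meant for transition
  maps.\<close>

lemma second_derivative_symmetric:
  fixes f :: "'a::euclidean_space \<Rightarrow> 'b::euclidean_space"
  assumes "open S" "x \<in> S" "smooth_on S f"
  shows "frechet_derivative (\<lambda>y. frechet_derivative f (at y) u) (at x) v =
         frechet_derivative (\<lambda>y. frechet_derivative f (at y) v) (at x) u"
proof (rule euclidean_eqI)
  fix b :: 'b assume "b \<in> Basis"
  have inner: "frechet_derivative (\<lambda>y. g y \<bullet> b) (at y) w = frechet_derivative g (at y) w \<bullet> b"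
    if "smooth_on S g" "y \<in> S" for g :: "'a \<Rightarrow> 'b" and y w
    by (rule fun_cong[OF frechet_eq[OF has_derivative_inner_left[OF
        frechet_has[OF smooth_on_differentiable[OF that]]]]])
  have "smooth_on S (\<lambda>y. f y \<bullet> b)"
    using assms Ck_on_linear_image[OF assms(1) bounded_linear_inner_left] unfolding smooth_on_def by blast
  note sym = second_derivative_symmetric_real[OF assms(1,2) this]
  have "frechet_derivative (\<lambda>y. frechet_derivative (\<lambda>y. f y \<bullet> b) (at y) u) (at x) v =
      frechet_derivative (\<lambda>y. frechet_derivative f (at y) u) (at x) v \<bullet> b" for u v
  proof -
    have "frechet_derivative (\<lambda>y. frechet_derivative (\<lambda>y. f y \<bullet> b) (at y) u) (at x) =
        frechet_derivative (\<lambda>y. frechet_derivative f (at y) u \<bullet> b) (at x)"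
      by (rule frechet_derivative_cong_open[OF assms(1,2)]) (rule inner[OF assms(3)])
    then show ?thesis by (simp add: inner[OF smooth_on_frechet[OF assms(3)] assms(2)])
  qed
  from this[of u v] this[of v u] sym[of u v]
  show "frechet_derivative (\<lambda>y. frechet_derivative f (at y) u) (at x) v \<bullet> b =
         frechet_derivative (\<lambda>y. frechet_derivative f (at y) v) (at x) u \<bullet> b" by simp
qed

section \<open>Exterior derivatives of one-forms\<close>


lemma chart_open: "smooth_manifold X A \<Longrightarrow> c \<in> A \<Longrightarrow> open (chart_image c)"
  by (auto simp: smooth_manifold_def is_chart_def)

lemma chart_homeomorphic:
  "smooth_manifold X A \<Longrightarrow> c \<in> A \<Longrightarrow>
    homeomorphic_map (subtopology X (fst c)) (top_of_set (chart_image c)) (snd c)"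
  by (auto simp: smooth_manifold_def is_chart_def)

lemma chart_domain: "smooth_manifold X A \<Longrightarrow> c \<in> A \<Longrightarrow> openin X (fst c)"
  by (auto simp: smooth_manifold_def is_chart_def)

lemma chart_topspace:
  assumes "smooth_manifold X A" "c \<in> A"
  shows "topspace (subtopology X (fst c)) = fst c"
  using openin_subset[OF chart_domain[OF assms]] by auto

lemma chart_inj:
  assumes "smooth_manifold X A" "c \<in> A"
  shows "inj_on (snd c) (fst c)"
  using chart_homeomorphic[OF assms] chart_topspace[OF assms]
  by (metis homeomorphic_eq_everything_map)

lemma chart_inv_chart:
  assumes "smooth_manifold X A" "c \<in> A" "p \<in> fst c"
  shows "chart_inv c (snd c p) = p"
  using inv_into_f_f[OF chart_inj[OF assms(1,2)] assms(3)] by (simp add: chart_inv_def)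

lemma chart_inv_mem: "y \<in> chart_image c \<Longrightarrow> chart_inv c y \<in> fst c"
  unfolding chart_inv_def chart_image_def by (rule inv_into_into)

lemma chart_chart_inv: "y \<in> chart_image c \<Longrightarrow> snd c (chart_inv c y) = y"
  unfolding chart_inv_def chart_image_def by (rule f_inv_into_f)

lemma chart_overlap_open:
  assumes "smooth_manifold X A" "c \<in> A" "d \<in> A"
  shows "open (snd c ` (fst c \<inter> fst d))"
proof -
  have "openin (subtopology X (fst c)) (fst c \<inter> fst d)"
    using chart_domain[OF assms(1,3)] by (auto simp: openin_subtopology)
  then have "openin (top_of_set (chart_image c)) (snd c ` (fst c \<inter> fst d))"
    using homeomorphic_map_openness_eq[OF chart_homeomorphic[OF assms(1,2)]] by blast
  then show ?thesis
    using chart_open[OF assms(1,2)] openin_open_trans by blast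
qed

lemma transition_smooth:
  assumes "smooth_manifold X A" "c \<in> A" "d \<in> A"
  shows "smooth_on (snd c ` (fst c \<inter> fst d)) (snd d \<circ> chart_inv c)"
  using assms by (auto simp: smooth_manifold_def)

text \<open>The two transition maps between \<open>c\<close> and \<open>d\<close> compose to the
  identity on the open overlap, so by the chain rule the derivative of one has a left
  inverse.\<close>

lemma transition_deriv_inj:
  assumes M: "smooth_manifold X A" "c \<in> A" "d \<in> A" and p: "p \<in> fst c \<inter> fst d"
  shows "inj (frechet_derivative (snd d \<circ> chart_inv c) (at (snd c p)))"
proof -
  let ?f = "snd d \<circ> chart_inv c" and ?g = "snd c \<circ> chart_inv d" and ?W = "snd c ` (fst c \<inter> fst d)"
  have fx: "?f (snd c p) = snd d p" using chart_inv_chart[OF M(1,2)] p by simp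
  have f: "?f differentiable (at (snd c p))"
    using smooth_on_differentiable[OF transition_smooth[OF M]] p by blast
  have "?g differentiable (at (snd d p))"
    using smooth_on_differentiable[OF transition_smooth[OF M(1,3,2)]] p by blast
  then have g: "?g differentiable (at (?f (snd c p)))" by (simp only: fx)
  have "?g (?f y) = y" if "y \<in> ?W" for y
    using that chart_inv_chart[OF M(1,2)] chart_inv_chart[OF M(1,3)] by auto
  then have "frechet_derivative (?g \<circ> ?f) (at (snd c p)) = frechet_derivative id (at (snd c p))"
    using p by (intro frechet_derivative_cong_open[OF chart_overlap_open[OF M]]) auto
  then have "frechet_derivative ?g (at (?f (snd c p))) \<circ> frechet_derivative ?f (at (snd c p)) = id"
    using frechet_derivative_compose[OF f g] by (simp only: frechet_derivative_id)
  then show ?thesis using inj_on_imageI2 inj_on_id by metis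
qed

section \<open>Forms of degree one and two as functions of single vectors\<close>

lemma alternating_formD:
  assumes "alternating_form k \<alpha>"
  shows "(\<And>i. i < k \<Longrightarrow> v i = w i) \<Longrightarrow> \<alpha> v = \<alpha> w"
    and "i < k \<Longrightarrow> linear (\<lambda>u. \<alpha> (v(i := u)))"
    and "i < k \<Longrightarrow> j < k \<Longrightarrow> i \<noteq> j \<Longrightarrow> v i = v j \<Longrightarrow> \<alpha> v = 0"
  using assms unfolding alternating_form_def by blast+

text \<open>Translates the encoding by sequences into an ordinary linear functional. A single vector
  \<open>u\<close> is fed to a one-form as the constant sequence
  \<open>\<lambda>_. u\<close>.\<close>

lemma alternating_form_1_iff:
  "alternating_form 1 \<alpha> \<longleftrightarrow> (\<forall>v. \<alpha> v = \<alpha> (\<lambda>_. v 0)) \<and> linear (\<lambda>u. \<alpha> (\<lambda>_. u))"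
proof (intro iffI conjI allI)
  assume a: "alternating_form 1 \<alpha>"
  show "\<alpha> v = \<alpha> (\<lambda>_. v 0)" for v
    by (rule alternating_formD(1)[OF a]) simp
  have "\<alpha> ((\<lambda>_. 0)(0 := u)) = \<alpha> (\<lambda>_. u)" for u
    by (rule alternating_formD(1)[OF a]) simp
  then show "linear (\<lambda>u. \<alpha> (\<lambda>_. u))"
    using alternating_formD(2)[OF a, of 0 "\<lambda>_. 0"] by simp
next
  assume a: "(\<forall>v. \<alpha> v = \<alpha> (\<lambda>_. v 0)) \<and> linear (\<lambda>u. \<alpha> (\<lambda>_. u))"
  have "\<alpha> v = \<alpha> w" if "v 0 = w 0" for v w
    using spec[OF conjunct1[OF a], of v] spec[OF conjunct1[OF a], of w] that by simp
  moreover have "linear (\<lambda>u. \<alpha> (v(0 := u)))" for v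
  proof -
    have "\<alpha> (v(0 := u)) = \<alpha> (\<lambda>_. u)" for u
      using spec[OF conjunct1[OF a], of "v(0 := u)"] by simp
    then show ?thesis using conjunct2[OF a] by simp
  qed
  ultimately show "alternating_form 1 \<alpha>"
    unfolding alternating_form_def less_one by blast
qed

lemma alternating_form_2_iff:
  "alternating_form 2 \<alpha> \<longleftrightarrow> (\<exists>B. \<alpha> = (\<lambda>v. B (v 0) (v 1)) \<and>
     (\<forall>b. linear (\<lambda>a. B a b)) \<and> (\<forall>a. linear (B a)) \<and> (\<forall>a. B a a = 0))"
proof
  assume a: "alternating_form 2 \<alpha>"
  define B where "B a b = \<alpha> (\<lambda>i. if i = 0 then a else b)" for a b
  have "\<alpha> v = B (v 0) (v 1)" for v
    unfolding B_def by (rule alternating_formD(1)[OF a]) (auto simp: less_2_cases_iff)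
  moreover have "linear (\<lambda>a. B a b)" for b
  proof -
    have "B x b = \<alpha> ((\<lambda>_. b)(0 := x))" for x
      unfolding B_def by (rule alternating_formD(1)[OF a]) auto
    then show ?thesis using alternating_formD(2)[OF a, of 0 "\<lambda>_. b"] by simp
  qed
  moreover have "linear (B b)" for b
  proof -
    have "B b x = \<alpha> ((\<lambda>_. b)(1 := x))" for x
      unfolding B_def by (rule alternating_formD(1)[OF a]) (auto simp: less_2_cases_iff)
    then have "B b = (\<lambda>x. \<alpha> ((\<lambda>_. b)(1 := x)))" by auto
    then show ?thesis using alternating_formD(2)[OF a, of 1 "\<lambda>_. b"] by simp
  qed
  moreover have "B b b = 0" for b
    unfolding B_def by (rule alternating_formD(3)[OF a, of 0 1]) auto
  ultimately show "\<exists>B. \<alpha> = (\<lambda>v. B (v 0) (v 1)) \<and>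
     (\<forall>b. linear (\<lambda>a. B a b)) \<and> (\<forall>a. linear (B a)) \<and> (\<forall>a. B a a = 0)"
    by (intro exI[of _ B]) auto
next
  assume "\<exists>B. \<alpha> = (\<lambda>v. B (v 0) (v 1)) \<and>
     (\<forall>b. linear (\<lambda>a. B a b)) \<and> (\<forall>a. linear (B a)) \<and> (\<forall>a. B a a = 0)"
  then obtain B where B: "\<alpha> = (\<lambda>v. B (v 0) (v 1))" "\<And>b. linear (\<lambda>a. B a b)" "\<And>a. linear (B a)"
    "\<And>a. B a a = 0" by auto
  then show "alternating_form 2 \<alpha>"
    unfolding alternating_form_def by (auto simp: less_2_cases_iff)
qed

lemma differential_form_1D:
  assumes "differential_form 1 A \<omega>" "c \<in> A"
  shows "x \<in> chart_image c \<Longrightarrow> \<omega> c x v = \<omega> c x (\<lambda>_. v 0)"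
    and "x \<in> chart_image c \<Longrightarrow> linear (\<lambda>u. \<omega> c x (\<lambda>_. u))"
    and "smooth_on (chart_image c) (\<lambda>x. \<omega> c x v)"
    and "d \<in> A \<Longrightarrow> p \<in> fst c \<inter> fst d \<Longrightarrow> \<omega> c (snd c p) (\<lambda>_. u) =
      \<omega> d (snd d p) (\<lambda>_. frechet_derivative (snd d \<circ> chart_inv c) (at (snd c p)) u)"
  using assms unfolding differential_form_def alternating_form_1_iff by blast+

lemma linear_form_expand:
  fixes f :: "'a::euclidean_space \<Rightarrow> 'b::real_vector"
  assumes "linear f"
  shows "f u = (\<Sum>b\<in>Basis. (u \<bullet> b) *\<^sub>R f b)"
proof -
  have "f u = f (\<Sum>b\<in>Basis. (u \<bullet> b) *\<^sub>R b)" by (simp add: euclidean_representation)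
  also have "\<dots> = (\<Sum>b\<in>Basis. (u \<bullet> b) *\<^sub>R f b)"
    by (simp add: linear_sum[OF assms] linear_scale[OF assms])
  finally show ?thesis .
qed

text \<open>The invariant formula for the exterior derivative of a one-form, evaluated on the
  constant vector fields \<open>a\<close> and \<open>b\<close> of a chart, whose Lie bracket is
  zero.\<close>

definition ext_deriv_at :: "('m, 'a::euclidean_space) form \<Rightarrow> ('m, 'a) chart \<Rightarrow> 'a \<Rightarrow> 'a \<Rightarrow> 'a \<Rightarrow> real" where
  "ext_deriv_at \<omega> c x a b = frechet_derivative (\<lambda>y. \<omega> c y (\<lambda>_. b)) (at x) a
                - frechet_derivative (\<lambda>y. \<omega> c y (\<lambda>_. a)) (at x) b"

lemma ext_deriv_1:
  assumes M: "smooth_manifold X A" and \<omega>: "differential_form 1 A \<omega>" and c: "c \<in> A"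
    and x: "x \<in> chart_image c"
  shows "ext_deriv 1 \<omega> c x v = ext_deriv_at \<omega> c x (v 0) (v 1)"
proof -
  have "frechet_derivative (\<lambda>y. \<omega> c y w) (at x) = frechet_derivative (\<lambda>y. \<omega> c y (\<lambda>_. w 0)) (at x)" for w
    by (rule frechet_derivative_cong_open[OF chart_open[OF M c] x]) (rule differential_form_1D(1)[OF \<omega> c])
  \<comment> \<open>Omitting index 0 leaves a sequence starting with \<open>v 1\<close>, omitting
    index 1 one starting with \<open>v 0\<close>; a one-form sees only this first entry.\<close>
  note this[of "\<lambda>j. v (if j < 0 then j else Suc j)"] this[of "\<lambda>j. v (if j < 1 then j else Suc j)"]
  then show ?thesis by (simp add: ext_deriv_def ext_deriv_at_def)
qed

text \<open>Concerns the vector fed to the form, not the direction of differentiation: linearity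
  holds at every point of the chart image and can therefore be differentiated.\<close>

lemma form_deriv_linear:
  assumes M: "smooth_manifold X A" and \<omega>: "differential_form 1 A \<omega>" and c: "c \<in> A"
    and x: "x \<in> chart_image c"
  shows "linear (\<lambda>u. frechet_derivative (\<lambda>y. \<omega> c y (\<lambda>_. u)) (at x) w)"
proof (rule linearI)
  note D = frechet_has[OF smooth_on_differentiable[OF differential_form_1D(3)[OF \<omega> c] x]]
  note lin = differential_form_1D(2)[OF \<omega> c]
  fix a b and r :: real
  have "frechet_derivative (\<lambda>y. \<omega> c y (\<lambda>_. a + b)) (at x) =
      frechet_derivative (\<lambda>y. \<omega> c y (\<lambda>_. a) + \<omega> c y (\<lambda>_. b)) (at x)"
    by (rule frechet_derivative_cong_open[OF chart_open[OF M c] x]) (simp add: linear_add[OF lin])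
  then show "frechet_derivative (\<lambda>y. \<omega> c y (\<lambda>_. a + b)) (at x) w =
      frechet_derivative (\<lambda>y. \<omega> c y (\<lambda>_. a)) (at x) w + frechet_derivative (\<lambda>y. \<omega> c y (\<lambda>_. b)) (at x) w"
    by (simp add: frechet_eq[OF has_derivative_add[OF D D]])
  have "frechet_derivative (\<lambda>y. \<omega> c y (\<lambda>_. r *\<^sub>R a)) (at x) =
      frechet_derivative (\<lambda>y. r *\<^sub>R \<omega> c y (\<lambda>_. a)) (at x)"
    by (rule frechet_derivative_cong_open[OF chart_open[OF M c] x]) (simp add: linear_scale[OF lin])
  then show "frechet_derivative (\<lambda>y. \<omega> c y (\<lambda>_. r *\<^sub>R a)) (at x) w =
      r *\<^sub>R frechet_derivative (\<lambda>y. \<omega> c y (\<lambda>_. a)) (at x) w"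
    by (simp only: frechet_eq[OF has_derivative_scaleR_right[OF D]])
qed

lemma form_deriv_linear':
  assumes \<omega>: "differential_form 1 A \<omega>" and c: "c \<in> A" and x: "x \<in> chart_image c"
  shows "linear (frechet_derivative (\<lambda>y. \<omega> c y (\<lambda>_. u)) (at x))"
  by (rule linear_frechet_derivative[OF smooth_on_differentiable[OF differential_form_1D(3)[OF \<omega> c] x]])

lemma ext_deriv_at_alternating:
  assumes M: "smooth_manifold X A" and \<omega>: "differential_form 1 A \<omega>" and c: "c \<in> A"
    and x: "x \<in> chart_image c"
  shows "linear (\<lambda>a. ext_deriv_at \<omega> c x a b)" "linear (ext_deriv_at \<omega> c x a)" "ext_deriv_at \<omega> c x a a = 0"
proof -
  show "linear (\<lambda>a. ext_deriv_at \<omega> c x a b)"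
    unfolding ext_deriv_at_def
    by (intro linear_compose_sub form_deriv_linear[OF assms] form_deriv_linear'[OF \<omega> c x])
  have "linear (\<lambda>b. ext_deriv_at \<omega> c x a b)"
    unfolding ext_deriv_at_def
    by (intro linear_compose_sub form_deriv_linear[OF assms] form_deriv_linear'[OF \<omega> c x])
  then show "linear (ext_deriv_at \<omega> c x a)" .
  show "ext_deriv_at \<omega> c x a a = 0" by (simp add: ext_deriv_at_def)
qed

lemma ext_deriv_at_smooth:
  assumes M: "smooth_manifold X A" and \<omega>: "differential_form 1 A \<omega>" and c: "c \<in> A"
  shows "smooth_on (chart_image c) (\<lambda>x. ext_deriv_at \<omega> c x a b)"
  unfolding ext_deriv_at_def
  by (intro smooth_on_diff chart_open[OF M c] smooth_on_frechet differential_form_1D(3)[OF \<omega> c])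

text \<open>The terms with second derivatives of the transition map cancel by symmetry.\<close>

lemma ext_deriv_at_transition:
  assumes M: "smooth_manifold X A" and \<omega>: "differential_form 1 A \<omega>" and c: "c \<in> A" and d: "d \<in> A"
    and p: "p \<in> fst c \<inter> fst d"
  defines "D \<equiv> frechet_derivative (snd d \<circ> chart_inv c) (at (snd c p))"
  shows "ext_deriv_at \<omega> c (snd c p) a b = ext_deriv_at \<omega> d (snd d p) (D a) (D b)"
proof -
  define \<tau> where "\<tau> = snd d \<circ> chart_inv c"
  define W where "W = snd c ` (fst c \<inter> fst d)"
  define x where "x = snd c p"
  have W: "open W" "x \<in> W" using chart_overlap_open[OF M c d] p by (auto simp: W_def x_def)
  have \<tau>x: "\<tau> x = snd d p" using p chart_inv_chart[OF M c] by (simp add: \<tau>_def x_def)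
  have \<tau>W: "\<tau> y \<in> chart_image d" if "y \<in> W" for y
    using that chart_inv_chart[OF M c] by (auto simp: \<tau>_def W_def chart_image_def)
  have smooth: "smooth_on W \<tau>" unfolding \<tau>_def W_def by (rule transition_smooth[OF M c d])
  \<comment> \<open>The Hessian of the transition map.\<close>
  define H where "H u w = frechet_derivative (\<lambda>y. frechet_derivative \<tau> (at y) u) (at x) w" for u w
  have sym: "H u w = H w u" for u w
    unfolding H_def by (rule second_derivative_symmetric[OF W smooth])
  have D\<tau>: "(\<tau> has_derivative D) (at x)"
    unfolding D_def \<tau>_def[symmetric] x_def[symmetric]
    by (rule frechet_has[OF smooth_on_differentiable[OF smooth W(2)]])
  have DD: "D u = frechet_derivative \<tau> (at x) u" for u by (simp add: D_def \<tau>_def x_def)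
  have x': "\<tau> x \<in> chart_image d" using \<tau>W W by blast
  \<comment> \<open>The term with \<open>H\<close> is the failure of a single directional derivative
    to be tensorial; antisymmetrizing in \<open>u\<close> and \<open>w\<close> removes it.\<close>
  have main: "frechet_derivative (\<lambda>y. \<omega> c y (\<lambda>_. u)) (at x) w =
      \<omega> d (\<tau> x) (\<lambda>_. H u w) + frechet_derivative (\<lambda>z. \<omega> d z (\<lambda>_. D u)) (at (\<tau> x)) (D w)" for u w
  proof -
    \<comment> \<open>The vector on which \<open>\<omega> d\<close> is evaluated varies with
      \<open>y\<close>, while smoothness is known only for fixed vectors. Expanding it in the basis
      makes the product rule applicable.\<close>
    have "\<omega> c y (\<lambda>_. u) = (\<Sum>b\<in>Basis. (frechet_derivative \<tau> (at y) u \<bullet> b) * \<omega> d (\<tau> y) (\<lambda>_. b))"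
      if yW: "y \<in> W" for y
    proof -
      obtain q where q: "q \<in> fst c \<inter> fst d" "y = snd c q" using yW unfolding W_def by blast
      have "\<omega> c y (\<lambda>_. u) = \<omega> d (\<tau> y) (\<lambda>_. frechet_derivative \<tau> (at y) u)"
      proof -
        have "\<tau> y = snd d q" using q chart_inv_chart[OF M c, of q] by (auto simp: \<tau>_def)
        then show ?thesis
          using differential_form_1D(4)[OF \<omega> c d q(1), of u] by (simp only: q(2) \<tau>_def)
      qed
      then show ?thesis
        using linear_form_expand[OF differential_form_1D(2)[OF \<omega> d \<tau>W[OF yW]],
            of "frechet_derivative \<tau> (at y) u"] by (simp only: real_scaleR_def)
    qed
    then have "frechet_derivative (\<lambda>y. \<omega> c y (\<lambda>_. u)) (at x) =
      frechet_derivative (\<lambda>y. \<Sum>b\<in>Basis. (frechet_derivative \<tau> (at y) u \<bullet> b) * \<omega> d (\<tau> y) (\<lambda>_. b)) (at x)"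
      by (rule frechet_derivative_cong_open[OF W])
    moreover have "((\<lambda>y. \<Sum>b\<in>Basis. (frechet_derivative \<tau> (at y) u \<bullet> b) * \<omega> d (\<tau> y) (\<lambda>_. b))
      has_derivative (\<lambda>w. \<Sum>b\<in>Basis. (frechet_derivative \<tau> (at x) u \<bullet> b) *
          frechet_derivative (\<lambda>z. \<omega> d z (\<lambda>_. b)) (at (\<tau> x)) (D w)
          + (H u w \<bullet> b) * \<omega> d (\<tau> x) (\<lambda>_. b))) (at x)"
    proof (intro has_derivative_sum has_derivative_mult has_derivative_inner_left)
      fix b :: 'b
      show "((\<lambda>y. frechet_derivative \<tau> (at y) u) has_derivative H u) (at x)"
        using frechet_has[OF smooth_on_differentiable[OF smooth_on_frechet[OF smooth] W(2)]]
        by (simp add: H_def[abs_def])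
      show "((\<lambda>y. \<omega> d (\<tau> y) (\<lambda>_. b)) has_derivative
          (\<lambda>w. frechet_derivative (\<lambda>z. \<omega> d z (\<lambda>_. b)) (at (\<tau> x)) (D w))) (at x)"
        using has_derivative_compose[OF D\<tau>
            frechet_has[OF smooth_on_differentiable[OF differential_form_1D(3)[OF \<omega> d] x']]] .
    qed
    ultimately have "frechet_derivative (\<lambda>y. \<omega> c y (\<lambda>_. u)) (at x) w =
      (\<Sum>b\<in>Basis. (D u \<bullet> b) *\<^sub>R frechet_derivative (\<lambda>z. \<omega> d z (\<lambda>_. b)) (at (\<tau> x)) (D w))
      + (\<Sum>b\<in>Basis. (H u w \<bullet> b) *\<^sub>R \<omega> d (\<tau> x) (\<lambda>_. b))"
      by (simp add: frechet_eq sum.distrib DD)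
    then show ?thesis
      using linear_form_expand[OF form_deriv_linear[OF M \<omega> d x'], of "D u" "D w"]
        linear_form_expand[OF differential_form_1D(2)[OF \<omega> d x'], of "H u w"] by linarith
  qed
  show ?thesis
    unfolding \<tau>x[symmetric] x_def[symmetric] ext_deriv_at_def main sym[of b a] by simp
qed

lemma differential_form_ext_deriv_1:
  assumes M: "smooth_manifold X A" and \<omega>: "differential_form 1 A \<omega>"
  shows "differential_form 2 A (ext_deriv 1 \<omega>)"
  unfolding differential_form_def
proof (intro conjI ballI allI)
  fix c assume c: "c \<in> A"
  show "alternating_form 2 (ext_deriv 1 \<omega> c x)" if "x \<in> chart_image c" for x
    unfolding alternating_form_2_iff
    using ext_deriv_1[OF M \<omega> c that] ext_deriv_at_alternating[OF M \<omega> c that]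
    by (intro exI[of _ "ext_deriv_at \<omega> c x"]) auto
  show "smooth_on (chart_image c) (\<lambda>x. ext_deriv 1 \<omega> c x v)" for v
    by (rule smooth_on_cong[OF chart_open[OF M c] _ ext_deriv_at_smooth[OF M \<omega> c, of "v 0" "v 1"]])
      (rule ext_deriv_1[OF M \<omega> c, symmetric])
  fix d p v assume d: "d \<in> A" and p: "p \<in> fst c \<inter> fst d"
  then have "snd c p \<in> chart_image c" "snd d p \<in> chart_image d" by (auto simp: chart_image_def)
  then show "ext_deriv 1 \<omega> c (snd c p) v = ext_deriv 1 \<omega> d (snd d p)
      (\<lambda>i. frechet_derivative (snd d \<circ> chart_inv c) (at (snd c p)) (v i))"
    by (simp only: ext_deriv_1[OF M \<omega> c] ext_deriv_1[OF M \<omega> d] ext_deriv_at_transition[OF M \<omega> c d p])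
qed

text \<open>Six second derivatives of the coefficients appear, and symmetry makes them cancel in
  pairs.\<close>

lemma ext_deriv_ext_deriv_1:
  assumes M: "smooth_manifold X A" and \<omega>: "differential_form 1 A \<omega>"
  shows "form_eq A (ext_deriv 2 (ext_deriv 1 \<omega>)) form_zero"
  unfolding form_eq_def
proof (intro ballI allI)
  fix c x v assume c: "c \<in> A" and x: "x \<in> chart_image c"
  define H where
    "H a b w = frechet_derivative (\<lambda>y. frechet_derivative (\<lambda>z. \<omega> c z (\<lambda>_. b)) (at y) a) (at x) w" for a b w
  have sym: "H a b w = H w b a" for a b w
    unfolding H_def
    by (rule second_derivative_symmetric_real[OF chart_open[OF M c] x differential_form_1D(3)[OF \<omega> c]])
  have "frechet_derivative (\<lambda>y. ext_deriv 1 \<omega> c y u) (at x) w = H (u 0) (u 1) w - H (u 1) (u 0) w" for u w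
  proof -
    have "frechet_derivative (\<lambda>y. ext_deriv 1 \<omega> c y u) (at x) = frechet_derivative (\<lambda>y. ext_deriv_at \<omega> c y (u 0) (u 1)) (at x)"
      by (rule frechet_derivative_cong_open[OF chart_open[OF M c] x]) (rule ext_deriv_1[OF M \<omega> c])
    moreover have D: "(\<lambda>y. frechet_derivative (\<lambda>z. \<omega> c z (\<lambda>_. b)) (at y) a) differentiable (at x)" for a b
      by (rule smooth_on_differentiable[OF smooth_on_frechet[OF differential_form_1D(3)[OF \<omega> c]] x])
    ultimately show ?thesis
      unfolding H_def ext_deriv_at_def by (simp add: frechet_eq[OF has_derivative_diff[OF frechet_has[OF D] frechet_has[OF D]]])
  qed
  moreover have atMost_2: "{..2::nat} = {0, 1, 2}" by auto
  ultimately have "ext_deriv 2 (ext_deriv 1 \<omega>) c x v =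
    (H (v 1) (v 2) (v 0) - H (v 2) (v 1) (v 0)) - (H (v 0) (v 2) (v 1) - H (v 2) (v 0) (v 1))
    + (H (v 0) (v 1) (v 2) - H (v 1) (v 0) (v 2))"
    
    unfolding ext_deriv_def[of 2] atMost_2
    by (simp add: One_nat_def[symmetric] numeral_2_eq_2[symmetric] del: One_nat_def)
  also have "\<dots> = 0"
    using sym[of "v 1" "v 2" "v 0"] sym[of "v 2" "v 1" "v 0"] sym[of "v 2" "v 0" "v 1"] by simp
  finally show "ext_deriv 2 (ext_deriv 1 \<omega>) c x v = form_zero c x v" by (simp add: form_zero_def)
qed

section \<open>Wedge products\<close>


text \<open>For each permutation exactly one of the two factors sees slot \<open>j\<close>, at the
  position \<open>m\<close> that is sent to \<open>j\<close>, so every summand is linear in that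
  slot. If two arguments agree, composing with their transposition flips the sign of a summand and
  keeps its values; the sum therefore equals its own negative.\<close>

lemma alt_wedge_alternating:
  assumes \<alpha>: "alternating_form k \<alpha>" and \<beta>: "alternating_form l \<beta>"
  shows "alternating_form (k + l) (alt_wedge k l \<alpha> \<beta>)"
  unfolding alternating_form_def
proof (intro conjI allI impI)
  let ?P = "{\<sigma>. \<sigma> permutes {..<k + l}}"
  fix v w :: "nat \<Rightarrow> 'a"
  assume vw: "\<forall>i<k + l. v i = w i"
  have "\<alpha> (\<lambda>i. v (\<sigma> i)) = \<alpha> (\<lambda>i. w (\<sigma> i))" "\<beta> (\<lambda>i. v (\<sigma> (k + i))) = \<beta> (\<lambda>i. w (\<sigma> (k + i)))"
    if "\<sigma> permutes {..<k + l}" for \<sigma>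
    using permutes_in_image[OF that] vw
    by (auto intro!: alternating_formD(1)[OF \<alpha>] alternating_formD(1)[OF \<beta>])
  then show "alt_wedge k l \<alpha> \<beta> v = alt_wedge k l \<alpha> \<beta> w"
    by (simp add: alt_wedge_def)
next
  fix j and v :: "nat \<Rightarrow> 'a" assume j: "j < k + l"
  have "linear (\<lambda>u. of_int (sign \<sigma>) * \<alpha> (\<lambda>i. (v(j := u)) (\<sigma> i)) * \<beta> (\<lambda>i. (v(j := u)) (\<sigma> (k + i))))"
    if \<sigma>: "\<sigma> permutes {..<k + l}" for \<sigma>
  proof -
    obtain m where m: "m < k + l" "\<sigma> m = j"
      using j permutes_image[OF \<sigma>] by (metis imageE lessThan_iff)
    have inj: "\<sigma> i = j \<longleftrightarrow> i = m" for i using m(2) permutes_inj[OF \<sigma>] by (metis injD)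
    show ?thesis
    proof (cases "m < k")
      case True
      have "\<alpha> (\<lambda>i. (v(j := u)) (\<sigma> i)) = \<alpha> ((\<lambda>i. v (\<sigma> i))(m := u))" for u
        by (rule arg_cong[of _ _ \<alpha>]) (auto simp: inj)
      moreover have "(\<lambda>i. (v(j := u)) (\<sigma> (k + i))) = (\<lambda>i. v (\<sigma> (k + i)))" for u
        using True by (auto simp: inj)
      ultimately show ?thesis
        using alternating_formD(2)[OF \<alpha> True, of "\<lambda>i. v (\<sigma> i)"]
        by (simp add: linear_iff algebra_simps)
    next
      case False
      then have ml: "m - k < l" using m by auto
      have "\<beta> (\<lambda>i. (v(j := u)) (\<sigma> (k + i))) = \<beta> ((\<lambda>i. v (\<sigma> (k + i)))(m - k := u))" for u
        using False by (intro arg_cong[of _ _ \<beta>]) (auto simp: inj fun_eq_iff)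
      moreover have "\<alpha> (\<lambda>i. (v(j := u)) (\<sigma> i)) = \<alpha> (\<lambda>i. v (\<sigma> i))" for u
        using False by (intro alternating_formD(1)[OF \<alpha>]) (auto simp: inj)
      ultimately show ?thesis
        using alternating_formD(2)[OF \<beta> ml, of "\<lambda>i. v (\<sigma> (k + i))"]
        by (simp add: linear_iff algebra_simps)
    qed
  qed
  then have "linear (\<lambda>u. \<Sum>\<sigma> | \<sigma> permutes {..<k + l}. of_int (sign \<sigma>) *
      \<alpha> (\<lambda>i. (v(j := u)) (\<sigma> i)) * \<beta> (\<lambda>i. (v(j := u)) (\<sigma> (k + i))))"
    by (intro linear_compose_sum) auto
  from linear_compose_scale_right[OF this, of "1 / (fact k * fact l)"]
  show "linear (\<lambda>u. alt_wedge k l \<alpha> \<beta> (v(j := u)))"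
    by (simp add: alt_wedge_def[abs_def])
next
  fix i j and v :: "nat \<Rightarrow> 'a"
  assume i: "i < k + l" and j: "j < k + l" and ij: "i \<noteq> j \<and> v i = v j"
  define f where "f \<sigma> = of_int (sign \<sigma>) * \<alpha> (\<lambda>i. v (\<sigma> i)) * \<beta> (\<lambda>i. v (\<sigma> (k + i)))" for \<sigma>
  let ?P = "{\<sigma>. \<sigma> permutes {..<k + l}}" and ?t = "Transposition.transpose i j"
  have t: "?t permutes {..<k + l}" using i j by (intro permutes_swap_id) auto
  have vt: "v (?t m) = v m" for m using ij by (auto simp: Transposition.transpose_def)
  have "f (?t \<circ> \<sigma>) = - f \<sigma>" if "\<sigma> \<in> ?P" for \<sigma>
  proof -
    have "permutation \<sigma>" using that finite_lessThan permutation_permutes by blast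
    then have "sign (?t \<circ> \<sigma>) = - sign \<sigma>"
      using ij by (simp add: sign_compose permutation_swap_id sign_swap_id)
    then show ?thesis by (simp add: f_def vt)
  qed
  then have "sum f ?P = sum (\<lambda>\<sigma>. - f \<sigma>) ?P"
    unfolding setum_permutations_compose_left[OF t, of f] by (intro sum.cong) auto
  then have "sum f ?P = 0" by (simp add: sum_negf)
  then show "alt_wedge k l \<alpha> \<beta> v = 0" by (simp add: alt_wedge_def f_def)
qed

lemma Ck_on_sum:
  "open S \<Longrightarrow> (\<And>i. i \<in> I \<Longrightarrow> Ck_on n S (f i)) \<Longrightarrow> Ck_on n S (\<lambda>x. \<Sum>i\<in>I. f i x)"
  by (induction I rule: infinite_finite_induct) (auto intro!: Ck_on_const Ck_on_add)

lemma differential_form_wedge: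
  assumes M: "smooth_manifold X A" and \<alpha>: "differential_form k A \<alpha>" and \<beta>: "differential_form l A \<beta>"
  shows "differential_form (k + l) A (wedge k l \<alpha> \<beta>)"
  unfolding differential_form_def
proof (intro conjI ballI allI)
  fix c assume c: "c \<in> A"
  show "alternating_form (k + l) (wedge k l \<alpha> \<beta> c x)" if "x \<in> chart_image c" for x
    using \<alpha> \<beta> c that by (auto simp: wedge_def differential_form_def intro: alt_wedge_alternating)
  have "Ck_on n (chart_image c) (\<lambda>x. \<Sum>\<sigma> | \<sigma> permutes {..<k + l}. (1 / (fact k * fact l) * of_int (sign \<sigma>)) *
      (\<alpha> c x (\<lambda>i. v (\<sigma> i)) * \<beta> c x (\<lambda>i. v (\<sigma> (k + i)))))" for v n
    using \<alpha> \<beta> c unfolding differential_form_def smooth_on_def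
    by (intro Ck_on_sum Ck_on_mult Ck_on_const chart_open[OF M c]) auto
  then show "smooth_on (chart_image c) (\<lambda>x. wedge k l \<alpha> \<beta> c x v)" for v
    by (simp add: smooth_on_def wedge_def alt_wedge_def sum_divide_distrib mult.assoc)
  fix d p v assume d: "d \<in> A" and p: "p \<in> fst c \<inter> fst d"
  have "\<alpha> c (snd c p) w = \<alpha> d (snd d p) (\<lambda>i. frechet_derivative (snd d \<circ> chart_inv c) (at (snd c p)) (w i))"
    "\<beta> c (snd c p) w = \<beta> d (snd d p) (\<lambda>i. frechet_derivative (snd d \<circ> chart_inv c) (at (snd c p)) (w i))" for w
    using \<alpha> \<beta> c d p unfolding differential_form_def by blast+
  then show "wedge k l \<alpha> \<beta> c (snd c p) v = wedge k l \<alpha> \<beta> d (snd d p)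
      (\<lambda>i. frechet_derivative (snd d \<circ> chart_inv c) (at (snd c p)) (v i))"
    by (simp add: wedge_def alt_wedge_def)
qed

text \<open>Polarization: expand \<open>B (a + b) (a + b) = 0\<close>.\<close>

lemma bilinear_antisym:
  assumes "\<And>b. linear (\<lambda>a. B a b)" "\<And>a. linear (B a)" "\<And>a. B a a = (0::real)"
  shows "B a b = - B b a"
proof -
  have "B (a + b) (a + b) = 0" using assms(3) .
  then show ?thesis
    using linear_add[OF assms(1)[of "a + b"], of a b] linear_add[OF assms(2)[of a], of a b]
      linear_add[OF assms(2)[of b], of a b] assms(3)[of a] assms(3)[of b] by simp
qed

text \<open>The six permutations fall into pairs that differ by exchanging the arguments of
  \<open>B\<close>; antisymmetry makes both members equal, which cancels the factor 1/2.\<close>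

lemma alt_wedge_1_2_eq:
  assumes "\<And>a b. B a b = - B b a"
  shows "alt_wedge 1 2 (\<lambda>v. a (v 0)) (\<lambda>v. B (v 0) (v 1)) w =
     a (w 0) * B (w 1) (w 2) - a (w 1) * B (w 0) (w 2) + a (w 2) * B (w 0) (w 1)"
proof -
  have S: "{..<1 + 2::nat} = insert 0 (insert 1 {2})" by auto
  have f: "finite {1::nat, 2}" "0 \<notin> {1::nat, 2}" "finite {2::nat}" "1 \<notin> {2::nat}" by auto
  have "alt_wedge 1 2 (\<lambda>v. a (v 0)) (\<lambda>v. B (v 0) (v 1)) w =
    (a (w 0) * (B (w 1) (w 2) - B (w 2) (w 1)) - a (w 1) * (B (w 0) (w 2) - B (w 2) (w 0))
      + a (w 2) * (B (w 0) (w 1) - B (w 1) (w 0))) / 2"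
    unfolding alt_wedge_def S sum_over_permutations_insert[OF f(1,2)]
      sum_over_permutations_insert[OF f(3,4)] permutes_sing
    by (simp add: sign_swap_id permutation_swap_id sign_compose sign_id Transposition.transpose_def algebra_simps permutation_compose
        One_nat_def[symmetric] del: One_nat_def)
  then show ?thesis
    using assms[of "w 2" "w 1"] assms[of "w 2" "w 0"] assms[of "w 1" "w 0"]
    by (simp add: field_simps del: One_nat_def)
qed

text \<open>The 24 permutations fall into groups of four with equal terms, cancelling the factor
  1/4. One term with its sign remains for each of the six shuffles.\<close>

lemma alt_wedge_2_2_eq:
  assumes "\<And>a b. B a b = - B b a" "\<And>a b. C a b = - C b a"
  shows "alt_wedge 2 2 (\<lambda>v. B (v 0) (v 1)) (\<lambda>v. C (v 0) (v 1)) w =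
     B (w 0) (w 1) * C (w 2) (w 3) - B (w 0) (w 2) * C (w 1) (w 3) + B (w 0) (w 3) * C (w 1) (w 2)
     + B (w 1) (w 2) * C (w 0) (w 3) - B (w 1) (w 3) * C (w 0) (w 2) + B (w 2) (w 3) * C (w 0) (w 1)"
proof -
  have S: "{..<2 + 2::nat} = insert 0 (insert 1 (insert 2 {3}))" by auto
  have f: "finite {1::nat, 2, 3}" "0 \<notin> {1::nat, 2, 3}" "finite {2::nat, 3}" "1 \<notin> {2::nat, 3}"
    "finite {3::nat}" "2 \<notin> {3::nat}" by auto
  note flips = assms(1)[of "w 1" "w 0"] assms(1)[of "w 2" "w 0"] assms(1)[of "w 3" "w 0"]
    assms(1)[of "w 2" "w 1"] assms(1)[of "w 3" "w 1"] assms(1)[of "w 3" "w 2"]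
    assms(2)[of "w 1" "w 0"] assms(2)[of "w 2" "w 0"] assms(2)[of "w 3" "w 0"]
    assms(2)[of "w 2" "w 1"] assms(2)[of "w 3" "w 1"] assms(2)[of "w 3" "w 2"]
  show ?thesis
    unfolding alt_wedge_def S sum_over_permutations_insert[OF f(1,2)]
      sum_over_permutations_insert[OF f(3,4)] sum_over_permutations_insert[OF f(5,6)] permutes_sing
    by (simp add: sign_swap_id permutation_swap_id sign_compose sign_id Transposition.transpose_def permutation_compose flips
        One_nat_def[symmetric] del: One_nat_def)
qed

section \<open>Linear algebra on three-space and its product with the line\<close>

lemma linear_functional_inner:
  assumes "linear (a :: real^3 \<Rightarrow> real)"
  obtains \<alpha> where "a = (\<lambda>u. \<alpha> \<bullet> u)"
proof
  show "a = (\<lambda>u. (\<Sum>b\<in>Basis. a b *\<^sub>R b) \<bullet> u)"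
  proof
    fix u
    have "a u = (\<Sum>b\<in>Basis. (u \<bullet> b) *\<^sub>R a b)" by (rule linear_form_expand[OF assms])
    then show "a u = (\<Sum>b\<in>Basis. a b *\<^sub>R b) \<bullet> u"
      by (simp add: inner_sum_left inner_commute[of u] mult.commute)
  qed
qed

text \<open>Hodge duality in dimension three: a two-form is the contraction of the determinant with
  a vector, whose coordinates are the values on the cyclically ordered pairs of basis vectors. It
  turns statements about forms into polynomial identities in coordinates.\<close>

lemma alternating_bilinear_cross3:
  fixes B :: "real^3 \<Rightarrow> real^3 \<Rightarrow> real"
  assumes B: "\<And>b. linear (\<lambda>a. B a b)" "\<And>a. linear (B a)" "\<And>a. B a a = 0"
  obtains \<beta> where "B = (\<lambda>u w. \<beta> \<bullet> cross3 u w)"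
proof
  let ?e = "\<lambda>i::3. axis i (1::real)"
  let ?\<beta> = "vector [B (?e 2) (?e 3), B (?e 3) (?e 1), B (?e 1) (?e 2)] :: real^3"
  have ex: "u = u $ 1 *\<^sub>R ?e 1 + u $ 2 *\<^sub>R ?e 2 + u $ 3 *\<^sub>R ?e 3" for u
    by (simp add: vec_eq_iff forall_3 axis_def)
  have L: "B u w = u$1 * B (?e 1) w + u$2 * B (?e 2) w + u$3 * B (?e 3) w" for u w
    by (subst ex[of u]) (simp add: linear_add[OF B(1)] linear_scale[OF B(1)])
  have R: "B u w = w$1 * B u (?e 1) + w$2 * B u (?e 2) + w$3 * B u (?e 3)" for u w
    by (subst ex[of w]) (simp add: linear_add[OF B(2)] linear_scale[OF B(2)])
  note anti = bilinear_antisym[of B, OF B]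
  show "B = (\<lambda>u w. ?\<beta> \<bullet> cross3 u w)"
  proof (intro ext)
    fix u w
    have "B u w = u$1 * (w$1 * B (?e 1) (?e 1) + w$2 * B (?e 1) (?e 2) + w$3 * B (?e 1) (?e 3))
      + u$2 * (w$1 * B (?e 2) (?e 1) + w$2 * B (?e 2) (?e 2) + w$3 * B (?e 2) (?e 3))
      + u$3 * (w$1 * B (?e 3) (?e 1) + w$2 * B (?e 3) (?e 2) + w$3 * B (?e 3) (?e 3))"
      using L[of u w] R[of "?e 1" w] R[of "?e 2" w] R[of "?e 3" w] by simp
    then show "B u w = ?\<beta> \<bullet> cross3 u w"
      using anti[of "?e 2" "?e 1"] anti[of "?e 3" "?e 2"] anti[of "?e 1" "?e 3"]
      by (simp add: B(3) cross3_def inner_vec_def sum_3 vector_3 algebra_simps)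
  qed
qed

lemma no_four_forms_in_three_dimensions:
  fixes u0 u1 u2 u3 \<beta> \<gamma> :: "real^3"
  defines "B \<equiv> \<lambda>u w. \<beta> \<bullet> cross3 u w" and "C \<equiv> \<lambda>u w. \<gamma> \<bullet> cross3 u w"
  shows "B u0 u1 * C u2 u3 - B u0 u2 * C u1 u3 + B u0 u3 * C u1 u2
     + B u1 u2 * C u0 u3 - B u1 u3 * C u0 u2 + B u2 u3 * C u0 u1 = 0"
  unfolding B_def C_def cross3_def inner_vec_def sum_3 vector_3 inner_real_def by algebra

text \<open>The value of \<open>d(e\<^sup>t \<omega>)\<close> on two tangent vectors \<open>(u, s)\<close>, \<open>(w, r)\<close> of the product with the line,
  where \<open>a\<close> and \<open>B\<close> are the values of \<open>\<omega>\<close> and \<open>d\<omega>\<close>, up to the factor \<open>e\<^sup>t\<close>.\<close>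

definition sympl :: "('a \<Rightarrow> real) \<Rightarrow> ('a \<Rightarrow> 'a \<Rightarrow> real) \<Rightarrow> 'a \<times> real \<Rightarrow> 'a \<times> real \<Rightarrow> real" where
  "sympl a B x y = snd x * a (fst y) - snd y * a (fst x) + B (fst x) (fst y)"

lemma sympl_antisym:
  assumes "\<And>a b. B a b = - B b a"
  shows "sympl a B x y = - sympl a B y x"
  using assms[of "fst x" "fst y"] by (simp add: sympl_def)

text \<open>The value of \<open>dt \<and> T\<close> for a three-form \<open>T\<close> on the base.\<close>

definition line_wedge :: "('a \<Rightarrow> 'a \<Rightarrow> 'a \<Rightarrow> real) \<Rightarrow> (nat \<Rightarrow> 'a \<times> real) \<Rightarrow> real" where
  "line_wedge T z =
     snd (z 0) * T (fst (z 1)) (fst (z 2)) (fst (z 3)) - snd (z 1) * T (fst (z 0)) (fst (z 2)) (fst (z 3))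
     + snd (z 2) * T (fst (z 0)) (fst (z 1)) (fst (z 3)) - snd (z 3) * T (fst (z 0)) (fst (z 1)) (fst (z 2))"

lemma line_wedge_scale: "line_wedge (\<lambda>u v w. k * T u v w) z = k * line_wedge T z"
  by (simp add: line_wedge_def algebra_simps)

lemma sympl_square:
  fixes a :: "real^3 \<Rightarrow> real" and f :: "'b \<Rightarrow> (real^3) \<times> real"
  assumes B: "\<And>b. linear (\<lambda>a. B a b)" "\<And>a. linear (B a)" "\<And>a. B a a = 0"
  shows "alt_wedge 2 2 (\<lambda>v. e * sympl a B (f (v 0)) (f (v 1))) (\<lambda>v. e * sympl a B (f (v 0)) (f (v 1))) v =
    2 * e\<^sup>2 * line_wedge (\<lambda>u v w. a u * B v w - a v * B u w + a w * B u v) (\<lambda>i. f (v i))"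
proof -
  have anti: "B a b = - B b a" for a b by (rule bilinear_antisym[of B, OF B])
  have anti': "e * sympl a B (f x) (f y) = - (e * sympl a B (f y) (f x))" for x y
    using sympl_antisym[of B a "f x" "f y", OF anti] by simp
  obtain u0 s0 u1 s1 u2 s2 u3 s3 where w: "f (v 0) = (u0, s0)" "f (v 1) = (u1, s1)"
    "f (v 2) = (u2, s2)" "f (v 3) = (u3, s3)" by (metis prod.exhaust)
  obtain \<beta> where "B = (\<lambda>u w. \<beta> \<bullet> cross3 u w)" by (rule alternating_bilinear_cross3[of B, OF B])
  with no_four_forms_in_three_dimensions[of \<beta> u0 u1 \<beta> u2 u3]
  have "B u0 u1 * B u2 u3 - B u0 u2 * B u1 u3 + B u0 u3 * B u1 u2
     + B u1 u2 * B u0 u3 - B u1 u3 * B u0 u2 + B u2 u3 * B u0 u1 = 0" by simp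
  then show ?thesis
    unfolding alt_wedge_2_2_eq[of "\<lambda>x y. e * sympl a B (f x) (f y)" "\<lambda>x y. e * sympl a B (f x) (f y)", OF anti' anti']
    unfolding line_wedge_def w sympl_def fst_conv snd_conv by algebra
qed

text \<open>Write \<open>a\<close> and \<open>B\<close> through vectors \<alpha> and \<beta>, and x
  = (u, s). Pairing \<open>x\<close> with the direction of the line gives \<alpha> . u = 0; pairing
  it with vectors of the base gives s \<alpha> + \<beta> x u = 0 (cross product). The inner product
  with \<beta> yields s = 0, and then the cross product with \<alpha> yields u = 0, each time
  because \<alpha> . \<beta> is nonzero.\<close>

lemma sympl_nondegenerate:
  fixes a :: "real^3 \<Rightarrow> real"
  assumes a: "linear a" and B: "\<And>b. linear (\<lambda>a. B a b)" "\<And>a. linear (B a)" "\<And>a. B a a = 0"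
    and contact: "a w0 * B w1 w2 - a w1 * B w0 w2 + a w2 * B w0 w1 \<noteq> 0"
    and null: "\<And>y. sympl a B x y = 0"
  shows "x = 0"
proof -
  obtain \<alpha> where \<alpha>: "a = (\<lambda>u. \<alpha> \<bullet> u)" by (rule linear_functional_inner[OF a])
  obtain \<beta> where \<beta>: "B = (\<lambda>u w. \<beta> \<bullet> cross3 u w)" by (rule alternating_bilinear_cross3[of B, OF B])
  have "a w0 * B w1 w2 - a w1 * B w0 w2 + a w2 * B w0 w1 = (\<alpha> \<bullet> \<beta>) * (w0 \<bullet> cross3 w1 w2)"
    unfolding \<alpha> \<beta> cross3_def inner_vec_def sum_3 vector_3 inner_real_def by algebra
  with contact have ab: "\<alpha> \<bullet> \<beta> \<noteq> 0" by auto
  have au: "\<alpha> \<bullet> fst x = 0" using null[of "(0, 1)"] by (simp add: sympl_def \<alpha> \<beta>)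
  have "(snd x *\<^sub>R \<alpha> + cross3 \<beta> (fst x)) \<bullet> w = 0" for w
  proof -
    have "\<beta> \<bullet> cross3 (fst x) w = cross3 \<beta> (fst x) \<bullet> w"
      unfolding cross3_def inner_vec_def sum_3 vector_3 inner_real_def by algebra
    then show ?thesis
      using null[of "(w, 0)"] by (simp add: sympl_def \<alpha> \<beta> inner_add_left)
  qed
  then have z: "snd x *\<^sub>R \<alpha> + cross3 \<beta> (fst x) = 0" using inner_eq_zero_iff by blast
  have "(snd x *\<^sub>R \<alpha> + cross3 \<beta> (fst x)) \<bullet> \<beta> = snd x * (\<alpha> \<bullet> \<beta>)"
    by (simp add: inner_add_left dot_cross_self)
  with z ab have s: "snd x = 0" by simp
  with z have "cross3 \<alpha> (cross3 \<beta> (fst x)) = 0" by simp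
  then have "(\<alpha> \<bullet> \<beta>) *\<^sub>R fst x = 0" by (simp add: Lagrange au)
  with ab have "fst x = 0" by simp
  with s show ?thesis by (simp add: prod_eq_iff)
qed

section \<open>The product with the line\<close>


text \<open>The model space of a four-manifold is fixed as \<open>real^4\<close>, so the product of
  \<open>real^3\<close> with the line is encoded there, the line being the fourth
  coordinate.\<close>

definition prj :: "real^4 \<Rightarrow> real^3" where
  "prj y = (\<chi> i. if i = 1 then y $ 1 else if i = 2 then y $ 2 else y $ 3)"

definition emb :: "real^3 \<Rightarrow> real \<Rightarrow> real^4" where
  "emb u s = (\<chi> i. if i = 1 then u $ 1 else if i = 2 then u $ 2 else if i = 3 then u $ 3 else s)"

lemma prj_emb [simp]: "prj (emb u s) = u"
  by (simp add: prj_def emb_def vec_eq_iff forall_3)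

lemma emb_4 [simp]: "emb u s $ 4 = s"
  by (simp add: emb_def)

lemma emb_prj [simp]: "emb (prj y) (y $ 4) = y"
  by (simp add: prj_def emb_def vec_eq_iff forall_4)

lemma emb_inject [simp]: "emb u s = emb w r \<longleftrightarrow> u = w \<and> s = r"
  by (metis prj_emb emb_4)

lemma bounded_linear_prj: "bounded_linear prj"
  by (intro linear_linear[THEN iffD2] linearI) (auto simp: prj_def vec_eq_iff forall_3)

lemma linear_emb: "linear (case_prod emb)"
  by (intro linearI) (auto simp: emb_def vec_eq_iff forall_4)

lemma bounded_linear_emb_0: "bounded_linear (\<lambda>u. emb u 0)"
  by (intro linear_linear[THEN iffD2] linearI) (auto simp: emb_def vec_eq_iff forall_4)

lemma bounded_linear_emb_line: "bounded_linear (emb 0)"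
  by (intro linear_linear[THEN iffD2] linearI) (auto simp: emb_def vec_eq_iff forall_4)

text \<open>Separates the base from the line into two linear maps, each of which can be
  differentiated on its own.\<close>

lemma emb_split: "emb u s = emb u 0 + emb 0 s"
  by (auto simp: emb_def vec_eq_iff forall_4)

lemma bounded_linear_4: "bounded_linear (\<lambda>y::real^4. y $ 4)"
  by (rule bounded_linear_vec_nth)

lemma open_prj_vimage: "open S \<Longrightarrow> open (prj -` S)"
  by (rule open_vimage) (auto intro: linear_continuous_on[OF bounded_linear_prj])

section \<open>The product atlas\<close>

definition lift_chart :: "('m, real^3) chart \<Rightarrow> ('m \<times> real, real^4) chart" where
  "lift_chart c = (fst c \<times> UNIV, \<lambda>(p, t). emb (snd c p) t)"

text \<open>Forms are functions of the chart, so a form on the product can only refer to the original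
  chart by recovering it from the lifted one.\<close>

definition unlift_chart :: "('m \<times> real, real^4) chart \<Rightarrow> ('m, real^3) chart" where
  "unlift_chart c = (fst ` fst c, \<lambda>p. prj (snd c (p, 0)))"

text \<open>An equality of pairs, hence also of the values outside the chart domain. It holds
  because \<open>lift_chart\<close> uses the total function \<open>snd c\<close>, and it is what
  lets a form on the product be indexed by the original chart.\<close>

lemma unlift_lift [simp]: "unlift_chart (lift_chart c) = c"
  by (auto simp: unlift_chart_def lift_chart_def prod_eq_iff)

lemma fst_lift_chart [simp]: "fst (lift_chart c) = fst c \<times> UNIV"
  and snd_lift_chart [simp]: "snd (lift_chart c) (p, t) = emb (snd c p) t"
  by (simp_all add: lift_chart_def)

lemma lift_chart_image_set: "snd (lift_chart c) ` (S \<times> UNIV) = prj -` (snd c ` S)"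
proof (intro equalityI subsetI)
  fix y assume "y \<in> prj -` (snd c ` S)"
  then obtain p where "p \<in> S" "prj y = snd c p" by auto
  then have "y = snd (lift_chart c) (p, y $ 4)" "p \<in> S" by (metis emb_prj snd_lift_chart)+
  then show "y \<in> snd (lift_chart c) ` (S \<times> UNIV)" by blast
qed auto

lemma chart_image_lift: "chart_image (lift_chart c) = prj -` chart_image c"
  unfolding chart_image_def fst_lift_chart lift_chart_image_set ..

lemma chart_inv_lift:
  assumes M: "smooth_manifold X A" "c \<in> A" and y: "prj y \<in> chart_image c"
  shows "chart_inv (lift_chart c) y = (chart_inv c (prj y), y $ 4)"
  unfolding chart_inv_def[of "lift_chart c"]
proof (rule inv_into_f_eq)
  show "inj_on (snd (lift_chart c)) (fst (lift_chart c))"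
    using chart_inj[OF M] by (auto simp: inj_on_def)
  show "(chart_inv c (prj y), y $ 4) \<in> fst (lift_chart c)"
    using chart_inv_mem[OF y] by simp
  show "snd (lift_chart c) (chart_inv c (prj y), y $ 4) = y"
    by (simp add: chart_chart_inv[OF y])
qed

lemma chart_inv_continuous:
  assumes M: "smooth_manifold X A" "c \<in> A"
  shows "continuous_map (top_of_set (chart_image c)) (subtopology X (fst c)) (chart_inv c)"
proof -
  obtain g where g: "homeomorphic_maps (subtopology X (fst c)) (top_of_set (chart_image c)) (snd c) g"
    using chart_homeomorphic[OF M] homeomorphic_map_maps by blast
  then have cont: "continuous_map (top_of_set (chart_image c)) (subtopology X (fst c)) g"
    and inv: "\<And>p. p \<in> fst c \<Longrightarrow> g (snd c p) = p"
    unfolding homeomorphic_maps_def chart_topspace[OF M] by auto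
  show ?thesis
  proof (rule continuous_map_eq[OF cont])
    fix y assume "y \<in> topspace (top_of_set (chart_image c))"
    then obtain p where "p \<in> fst c" "y = snd c p" by (auto simp: chart_image_def)
    then show "g y = chart_inv c y" using inv chart_inv_chart[OF M] by simp
  qed
qed

lemma is_chart_lift:
  assumes M: "smooth_manifold X A" "c \<in> A"
  shows "is_chart (prod_topology X euclideanreal) (lift_chart c)"
  unfolding is_chart_def
proof (intro conjI)
  show "openin (prod_topology X euclideanreal) (fst (lift_chart c))"
    using chart_domain[OF M] by (simp add: openin_prod_Times_iff)
  show op: "open (chart_image (lift_chart c))"
    unfolding chart_image_lift by (rule open_prj_vimage[OF chart_open[OF M]])
  let ?X = "subtopology (prod_topology X euclideanreal) (fst (lift_chart c))"
  have X: "?X = prod_topology (subtopology X (fst c)) euclideanreal"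
    by (simp add: subtopology_Times)
  have topX: "topspace ?X = fst c \<times> UNIV"
    unfolding X topspace_prod_topology chart_topspace[OF M] by simp
  let ?g = "\<lambda>y. (chart_inv c (prj y), y $ 4)"
  have "continuous_map (subtopology X (fst c)) euclidean (snd c)"
    using homeomorphic_imp_continuous_map[OF chart_homeomorphic[OF M]] continuous_map_in_subtopology by blast
  then have "continuous_map ?X (prod_topology euclidean euclidean) (\<lambda>z. (snd c (fst z), snd z))"
    unfolding X by (intro continuous_map_pairedI continuous_map_snd continuous_map_compose[OF continuous_map_fst, unfolded comp_def])
  moreover have "continuous_map (prod_topology euclidean euclidean) euclidean (case_prod emb)"
    using linear_continuous_on[OF linear_linear[THEN iffD2, OF linear_emb], of UNIV] by simp
  ultimately have "continuous_map ?X euclidean (case_prod emb \<circ> (\<lambda>z. (snd c (fst z), snd z)))"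
    by (rule continuous_map_compose)
  moreover have "case_prod emb \<circ> (\<lambda>z. (snd c (fst z), snd z)) = snd (lift_chart c)"
    by (auto simp: lift_chart_def)
  ultimately have f: "continuous_map ?X (top_of_set (chart_image (lift_chart c))) (snd (lift_chart c))"
    unfolding continuous_map_in_subtopology topX by (auto simp: chart_image_def)
  have "continuous_map (top_of_set (prj -` chart_image c)) (top_of_set (chart_image c)) prj"
    using linear_continuous_on[OF bounded_linear_prj] by auto
  from continuous_map_compose[OF this chart_inv_continuous[OF M]]
  have "continuous_map (top_of_set (prj -` chart_image c)) (subtopology X (fst c)) (\<lambda>y. chart_inv c (prj y))"
    by (simp add: comp_def)
  moreover have "continuous_map (top_of_set (prj -` chart_image c)) euclideanreal (\<lambda>y. y $ 4)"
    using linear_continuous_on[OF bounded_linear_4] by auto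
  ultimately have g: "continuous_map (top_of_set (chart_image (lift_chart c))) ?X ?g"
    unfolding X chart_image_lift by (rule continuous_map_pairedI)
  have "homeomorphic_maps ?X (top_of_set (chart_image (lift_chart c))) (snd (lift_chart c)) ?g"
    unfolding homeomorphic_maps_def topX
    using f g by (auto simp: chart_image_lift chart_inv_chart[OF M] chart_chart_inv)
  then show "homeomorphic_map ?X (top_of_set (chart_image (lift_chart c))) (snd (lift_chart c))"
    using homeomorphic_map_maps by blast
qed

lemma second_countable_prod_euclideanreal:
  assumes "second_countable X"
  shows "second_countable (prod_topology X euclideanreal)"
proof -
  obtain B where B: "countable B" "\<forall>V\<in>B. openin X V"
    "\<forall>U x. openin X U \<and> x \<in> U \<longrightarrow> (\<exists>V\<in>B. x \<in> V \<and> V \<subseteq> U)"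
    using assms unfolding second_countable_def by (elim exE conjE) (rule that)
  obtain D :: "real set set" where D: "countable D" "topological_basis D"
    using ex_countable_basis by blast
  show ?thesis
    unfolding second_countable_def
  proof (intro exI[of _ "(\<lambda>(V, W). V \<times> W) ` (B \<times> D)"] conjI ballI allI impI)
    show "countable ((\<lambda>(V, W). V \<times> W) ` (B \<times> D))" using B D by auto
    show "openin (prod_topology X euclideanreal) V" if "V \<in> (\<lambda>(V, W). V \<times> W) ` (B \<times> D)" for V
      using that B(2) topological_basis_open[OF D(2)] by (auto simp: openin_prod_Times_iff)
    fix U and z :: "'a \<times> real" assume U: "openin (prod_topology X euclideanreal) U \<and> z \<in> U"
    obtain x t where z: "z = (x, t)" by (cases z)
    obtain P Q where PQ: "openin X P" "openin euclideanreal Q" "x \<in> P" "t \<in> Q" "P \<times> Q \<subseteq> U"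
      using U unfolding z openin_prod_topology_alt by metis
    obtain V where V: "V \<in> B" "x \<in> V" "V \<subseteq> P" using B(3) PQ by blast
    obtain W where W: "W \<in> D" "t \<in> W" "W \<subseteq> Q"
      using topological_basisE[OF D(2)] PQ by (metis open_openin)
    show "\<exists>V\<in>(\<lambda>(V, W). V \<times> W) ` (B \<times> D). z \<in> V \<and> V \<subseteq> U"
      using V W PQ(5) unfolding z by (intro bexI[of _ "V \<times> W"]) auto
  qed
qed

text \<open>A transition map of the product is that of the base times the identity of the line,
  written as a sum of two maps with linear outer parts.\<close>

lemma lift_transition:
  assumes M: "smooth_manifold X A" "c \<in> A" and y: "prj y \<in> snd c ` (fst c \<inter> fst d)"
  shows "(snd (lift_chart d) \<circ> chart_inv (lift_chart c)) y =
    emb ((snd d \<circ> chart_inv c) (prj y)) 0 + emb 0 (y $ 4)"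
proof -
  have "prj y \<in> chart_image c" using y by (auto simp: chart_image_def)
  then show ?thesis by (simp add: chart_inv_lift[OF M] emb_split[symmetric])
qed

lemma lift_overlap:
  "snd (lift_chart c) ` (fst (lift_chart c) \<inter> fst (lift_chart d)) = prj -` (snd c ` (fst c \<inter> fst d))"
  using lift_chart_image_set[of c "fst c \<inter> fst d"] by (simp add: Times_Int_Times)

lemma lift_transition_smooth:
  assumes M: "smooth_manifold X A" "c \<in> A" "d \<in> A"
  shows "smooth_on (prj -` (snd c ` (fst c \<inter> fst d))) (snd (lift_chart d) \<circ> chart_inv (lift_chart c))"
proof (rule smooth_on_cong)
  let ?W = "snd c ` (fst c \<inter> fst d)"
  show op: "open (prj -` ?W)" by (rule open_prj_vimage[OF chart_overlap_open[OF M]])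
  show "emb ((snd d \<circ> chart_inv c) (prj y)) 0 + emb 0 (y $ 4) =
      (snd (lift_chart d) \<circ> chart_inv (lift_chart c)) y" if "y \<in> prj -` ?W" for y
    using lift_transition[OF M(1,2)] that by auto
  have "Ck_on n (prj -` ?W) (\<lambda>y. (snd d \<circ> chart_inv c) (prj y))" for n
    using transition_smooth[OF M] unfolding smooth_on_def
    by (intro Ck_on_linear_compose[OF op bounded_linear_prj, where f = "snd d \<circ> chart_inv c" and S = ?W]) auto
  moreover have "Ck_on n (prj -` ?W) (\<lambda>y. emb 0 (y $ 4))" for n
    by (intro Ck_on_linear[OF op] bounded_linear_compose[OF bounded_linear_emb_line bounded_linear_4])
  ultimately show "smooth_on (prj -` ?W) (\<lambda>y. emb ((snd d \<circ> chart_inv c) (prj y)) 0 + emb 0 (y $ 4))"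
    unfolding smooth_on_def
    by (intro allI Ck_on_add[OF op] Ck_on_linear_image[OF op bounded_linear_emb_0])
qed

text \<open>The fourth component of a vector is the same in all lifted charts, which is why dt is a
  well-defined form on the product.\<close>

lemma lift_transition_deriv:
  assumes M: "smooth_manifold X A" "c \<in> A" "d \<in> A" and y: "prj y \<in> snd c ` (fst c \<inter> fst d)"
  shows "frechet_derivative (snd (lift_chart d) \<circ> chart_inv (lift_chart c)) (at y) v =
    emb (frechet_derivative (snd d \<circ> chart_inv c) (at (prj y)) (prj v)) (v $ 4)"
proof -
  let ?W = "snd c ` (fst c \<inter> fst d)" and ?\<tau> = "snd d \<circ> chart_inv c"
  have op: "open (prj -` ?W)" by (rule open_prj_vimage[OF chart_overlap_open[OF M]])
  have "frechet_derivative (snd (lift_chart d) \<circ> chart_inv (lift_chart c)) (at y) =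
      frechet_derivative (\<lambda>y. emb (?\<tau> (prj y)) 0 + emb 0 (y $ 4)) (at y)"
  proof (rule frechet_derivative_cong_open[OF op])
    show "(snd (lift_chart d) \<circ> chart_inv (lift_chart c)) z = emb (?\<tau> (prj z)) 0 + emb 0 (z $ 4)"
      if "z \<in> prj -` ?W" for z
      using lift_transition[OF M(1,2)] that by auto
  qed (use y in simp)
  moreover have "((\<lambda>y. emb (?\<tau> (prj y)) 0 + emb 0 (y $ 4)) has_derivative
      (\<lambda>v. emb (frechet_derivative ?\<tau> (at (prj y)) (prj v)) 0 + emb 0 (v $ 4))) (at y)"
  proof (intro has_derivative_add bounded_linear.has_derivative[OF bounded_linear_emb_0])
    show "((\<lambda>y. ?\<tau> (prj y)) has_derivative (\<lambda>v. frechet_derivative ?\<tau> (at (prj y)) (prj v))) (at y)"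
      by (rule has_derivative_compose[OF bounded_linear_imp_has_derivative[OF bounded_linear_prj]
            frechet_has[OF smooth_on_differentiable[OF transition_smooth[OF M] y]]])
    show "((\<lambda>y. emb 0 (y $ 4)) has_derivative (\<lambda>v. emb 0 (v $ 4))) (at y)"
      by (intro bounded_linear_imp_has_derivative bounded_linear_compose[OF bounded_linear_emb_line bounded_linear_4])
  qed
  ultimately show ?thesis by (simp add: frechet_eq emb_split[symmetric])
qed

lemma smooth_manifold_lift:
  assumes M: "smooth_manifold X A"
  shows "smooth_manifold (prod_topology X euclideanreal) (lift_chart ` A)"
  unfolding smooth_manifold_def
proof (intro conjI ballI)
  show "Hausdorff_space (prod_topology X euclideanreal)"
    using M by (simp add: smooth_manifold_def Hausdorff_space_prod_topology)
  show "second_countable (prod_topology X euclideanreal)"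
    using M by (simp add: smooth_manifold_def second_countable_prod_euclideanreal)
  show "is_chart (prod_topology X euclideanreal) c'" if "c' \<in> lift_chart ` A" for c'
    using that is_chart_lift[OF M] by auto
  have "(\<Union>c\<in>A. fst c) = topspace X" using M by (simp add: smooth_manifold_def)
  then show "(\<Union>c'\<in>lift_chart ` A. fst c') = topspace (prod_topology X euclideanreal)" by auto
  fix c' d' assume "c' \<in> lift_chart ` A" "d' \<in> lift_chart ` A"
  then show "smooth_on (snd c' ` (fst c' \<inter> fst d')) (snd d' \<circ> chart_inv c')"
    using lift_transition_smooth[OF M] by (auto simp: lift_overlap simp del: fst_lift_chart)
qed

text \<open>The projection \<open>fst\<close> is a continuous left inverse, so the map is a
  topological embedding. In charts it is a transition map of the base followed by a linear
  injection, so the immersion property reduces to \<open>transition_deriv_inj\<close>.\<close>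

lemma smooth_embedding_zero_section:
  assumes M: "smooth_manifold X A"
  shows "smooth_embedding X A (prod_topology X euclideanreal) (lift_chart ` A) (\<lambda>p. (p, 0))"
proof -
  let ?\<iota> = "\<lambda>p. (p, 0::real)"
  have cont: "continuous_map X (prod_topology X euclideanreal) ?\<iota>"
    by (intro continuous_map_pairedI) auto
  have local: "snd (lift_chart d) \<circ> ?\<iota> \<circ> chart_inv c = (\<lambda>x. emb ((snd d \<circ> chart_inv c) x) 0)" for c d :: "('a, real^3) chart"
    by auto
  have "smooth_on (snd c ` {p \<in> fst c. ?\<iota> p \<in> fst (lift_chart d)}) (snd (lift_chart d) \<circ> ?\<iota> \<circ> chart_inv c)"
    if "c \<in> A" "d \<in> A" for c d
  proof -
    have dom: "{p \<in> fst c. ?\<iota> p \<in> fst (lift_chart d)} = fst c \<inter> fst d" by auto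
    show ?thesis
      using transition_smooth[OF M that] unfolding local dom smooth_on_def
      by (intro allI Ck_on_linear_image[OF chart_overlap_open[OF M that] bounded_linear_emb_0]) blast
  qed
  with cont have sm: "smooth_map X A (prod_topology X euclideanreal) (lift_chart ` A) ?\<iota>"
    by (auto simp: smooth_map_def simp del: fst_lift_chart)
  have "inj (frechet_derivative (snd (lift_chart d) \<circ> ?\<iota> \<circ> chart_inv c) (at (snd c p)))"
    if c: "c \<in> A" and d: "d \<in> A" and p: "p \<in> fst c" "?\<iota> p \<in> fst (lift_chart d)" for c d p
  proof -
    have p': "p \<in> fst c \<inter> fst d" using p by simp
    have "(snd d \<circ> chart_inv c) differentiable (at (snd c p))"
      using smooth_on_differentiable[OF transition_smooth[OF M c d]] p' by blast
    from bounded_linear.has_derivative[OF bounded_linear_emb_0 frechet_has[OF this]]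
    have "frechet_derivative (snd (lift_chart d) \<circ> ?\<iota> \<circ> chart_inv c) (at (snd c p)) =
        (\<lambda>v. emb (frechet_derivative (snd d \<circ> chart_inv c) (at (snd c p)) v) 0)"
      unfolding local by (rule frechet_eq)
    then show ?thesis
      using transition_deriv_inj[OF M c d p'] by (simp add: inj_def)
  qed
  with sm have imm: "immersion X A (prod_topology X euclideanreal) (lift_chart ` A) ?\<iota>"
    by (auto simp: immersion_def simp del: fst_lift_chart)
  have "retraction_maps (prod_topology X euclideanreal) X fst ?\<iota>"
    unfolding retraction_maps_def by (intro conjI cont continuous_map_fst) simp
  then have "embedding_map X (prod_topology X euclideanreal) ?\<iota>"
    using section_imp_embedding_map section_map_def by blast
  with imm show ?thesis by (simp add: smooth_embedding_def)
qed

section \<open>The form e^t \<omega> on the product and its exterior derivative\<close>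

definition lift_form :: "('m, real^3) form \<Rightarrow> ('m \<times> real, real^4) form" where
  "lift_form \<omega> = (\<lambda>c y v. exp (y $ 4) * \<omega> (unlift_chart c) (prj y) (\<lambda>i. prj (v i)))"

lemma differential_form_lift_form:
  assumes M: "smooth_manifold X A" and \<omega>: "differential_form 1 A \<omega>"
  shows "differential_form 1 (lift_chart ` A) (lift_form \<omega>)"
proof -
  have "alternating_form 1 (lift_form \<omega> (lift_chart c) y)"
    if c: "c \<in> A" and y: "y \<in> chart_image (lift_chart c)" for c y
  proof -
    have y': "prj y \<in> chart_image c" using y by (simp add: chart_image_lift)
    have "linear (\<lambda>u. \<omega> c (prj y) (\<lambda>_. prj u))"
      using linear_compose[OF bounded_linear.linear[OF bounded_linear_prj] differential_form_1D(2)[OF \<omega> c y']]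
      by (simp add: comp_def)
    then have "linear (\<lambda>u. exp (y $ 4) * \<omega> c (prj y) (\<lambda>_. prj u))"
      using linear_compose_scale_right[of "\<lambda>u. \<omega> c (prj y) (\<lambda>_. prj u)" "exp (y $ 4)"] by simp
    moreover have "lift_form \<omega> (lift_chart c) y v = lift_form \<omega> (lift_chart c) y (\<lambda>_. v 0)" for v
      using differential_form_1D(1)[OF \<omega> c y', of "\<lambda>i. prj (v i)"] by (simp only: lift_form_def unlift_lift)
    ultimately show ?thesis
      unfolding alternating_form_1_iff by (simp add: lift_form_def)
  qed
  moreover have "smooth_on (chart_image (lift_chart c)) (\<lambda>y. lift_form \<omega> (lift_chart c) y v)"
    if c: "c \<in> A" for c v
  proof -
    have op: "open (prj -` chart_image c)" by (rule open_prj_vimage[OF chart_open[OF M c]])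
    have "Ck_on n (prj -` chart_image c) (\<lambda>y. exp (y $ 4) * \<omega> c (prj y) (\<lambda>i. prj (v i)))" for n
      using differential_form_1D(3)[OF \<omega> c] unfolding smooth_on_def
      by (intro Ck_on_mult[OF op] Ck_on_exp_linear[OF op bounded_linear_4]
          Ck_on_linear_compose[OF op bounded_linear_prj]) auto
    then show ?thesis by (simp add: lift_form_def smooth_on_def chart_image_lift)
  qed
  moreover have "lift_form \<omega> (lift_chart c) (snd (lift_chart c) q) v = lift_form \<omega> (lift_chart d) (snd (lift_chart d) q)
      (\<lambda>i. frechet_derivative (snd (lift_chart d) \<circ> chart_inv (lift_chart c)) (at (snd (lift_chart c) q)) (v i))"
    if c: "c \<in> A" and d: "d \<in> A" and q: "q \<in> fst (lift_chart c) \<inter> fst (lift_chart d)" for c d q v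
  proof -
    obtain p t where pt: "q = (p, t)" by (cases q)
    have p: "p \<in> fst c \<inter> fst d" using q pt by auto
    then have "prj (snd (lift_chart c) q) \<in> snd c ` (fst c \<inter> fst d)" by (simp add: pt)
    note deriv = lift_transition_deriv[OF M c d this]
    have "\<omega> c (snd c p) w =
        \<omega> d (snd d p) (\<lambda>i. frechet_derivative (snd d \<circ> chart_inv c) (at (snd c p)) (w i))" for w
      using \<omega> c d p unfolding differential_form_def by blast
    then show ?thesis unfolding lift_form_def deriv by (simp add: pt)
  qed
  ultimately show ?thesis unfolding differential_form_def ball_simps(9) by blast
qed

definition decomp :: "real^4 \<Rightarrow> (real^3) \<times> real" where
  "decomp y = (prj y, y $ 4)"

lemma decomp_emb [simp]: "decomp (emb u s) = (u, s)"
  by (simp add: decomp_def)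

lemma decomp_eq_0_iff: "decomp y = 0 \<longleftrightarrow> y = 0"
  by (metis decomp_def emb_prj linear_0[OF linear_emb] case_prod_conv fst_conv snd_conv prod.collapse decomp_emb)

lemma ext_deriv_lift_form:
  assumes M: "smooth_manifold X A" and \<omega>: "differential_form 1 A \<omega>" and c: "c \<in> A"
    and y: "prj y \<in> chart_image c"
  shows "ext_deriv 1 (lift_form \<omega>) (lift_chart c) y v =
    exp (y $ 4) * sympl (\<lambda>u. \<omega> c (prj y) (\<lambda>_. u)) (ext_deriv_at \<omega> c (prj y)) (decomp (v 0)) (decomp (v 1))"
proof -
  have "frechet_derivative (\<lambda>y. lift_form \<omega> (lift_chart c) y (\<lambda>_. b)) (at y) a = exp (y $ 4) *
     (a $ 4 * \<omega> c (prj y) (\<lambda>_. prj b) + frechet_derivative (\<lambda>x. \<omega> c x (\<lambda>_. prj b)) (at (prj y)) (prj a))" for a b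
  proof -
    have exp: "((\<lambda>y::real^4. exp (y $ 4)) has_derivative (\<lambda>a. exp (y $ 4) * a $ 4)) (at y)"
      using has_derivative_exp[OF bounded_linear_imp_has_derivative[OF bounded_linear_4]]
      by (simp add: mult.commute)
    have "((\<lambda>y. exp (y $ 4) * \<omega> c (prj y) (\<lambda>_. prj b)) has_derivative
       (\<lambda>a. exp (y $ 4) * frechet_derivative (\<lambda>x. \<omega> c x (\<lambda>_. prj b)) (at (prj y)) (prj a)
          + (exp (y $ 4) * a $ 4) * \<omega> c (prj y) (\<lambda>_. prj b))) (at y)"
      by (intro has_derivative_mult exp
          has_derivative_compose[OF bounded_linear_imp_has_derivative[OF bounded_linear_prj]
            frechet_has[OF smooth_on_differentiable[OF differential_form_1D(3)[OF \<omega> c] y]]])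
    then show ?thesis unfolding lift_form_def unlift_lift by (simp add: frechet_eq algebra_simps)
  qed
  then have "ext_deriv_at (lift_form \<omega>) (lift_chart c) y a b =
    exp (y $ 4) * sympl (\<lambda>u. \<omega> c (prj y) (\<lambda>_. u)) (ext_deriv_at \<omega> c (prj y)) (decomp a) (decomp b)" for a b
    by (simp add: ext_deriv_at_def sympl_def decomp_def algebra_simps)
  then show ?thesis
    using ext_deriv_1[OF smooth_manifold_lift[OF M] differential_form_lift_form[OF M \<omega>], of "lift_chart c" y v] c y
    by (simp only: chart_image_lift image_eqI vimage_eq)
qed


lemma wedge_1_2_eq:
  assumes M: "smooth_manifold X A" and \<omega>: "differential_form 1 A \<omega>" and \<eta>: "differential_form 1 A \<eta>"
    and c: "c \<in> A" and x: "x \<in> chart_image c"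
  shows "wedge 1 2 \<omega> (ext_deriv 1 \<eta>) c x w = \<omega> c x (\<lambda>_. w 0) * ext_deriv_at \<eta> c x (w 1) (w 2)
    - \<omega> c x (\<lambda>_. w 1) * ext_deriv_at \<eta> c x (w 0) (w 2) + \<omega> c x (\<lambda>_. w 2) * ext_deriv_at \<eta> c x (w 0) (w 1)"
proof -
  have "\<omega> c x = (\<lambda>v. \<omega> c x (\<lambda>_. v 0))"
    by (rule ext) (rule differential_form_1D(1)[OF \<omega> c x])
  moreover have "ext_deriv 1 \<eta> c x = (\<lambda>v. ext_deriv_at \<eta> c x (v 0) (v 1))"
    by (rule ext) (rule ext_deriv_1[OF M \<eta> c x])
  ultimately have "wedge 1 2 \<omega> (ext_deriv 1 \<eta>) c x w =
      alt_wedge 1 2 (\<lambda>v. \<omega> c x (\<lambda>_. v 0)) (\<lambda>v. ext_deriv_at \<eta> c x (v 0) (v 1)) w"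
    unfolding wedge_def by (rule arg_cong2)
  then show ?thesis
    using alt_wedge_1_2_eq[of "ext_deriv_at \<eta> c x" "\<lambda>u. \<omega> c x (\<lambda>_. u)" w,
        OF bilinear_antisym[of "ext_deriv_at \<eta> c x", OF ext_deriv_at_alternating[OF M \<eta> c x]]] by (rule trans)
qed

lemma symplectic_form_lift:
  assumes M: "smooth_manifold X A" and \<omega>: "contact_form A \<omega>"
  shows "symplectic_form (lift_chart ` A) (ext_deriv 1 (lift_form \<omega>))"
  unfolding symplectic_form_def
proof (intro conjI ballI allI impI)
  have \<omega>1: "differential_form 1 A \<omega>" using \<omega> by (simp add: contact_form_def)
  note M' = smooth_manifold_lift[OF M] and \<omega>' = differential_form_lift_form[OF M \<omega>1]
  show "differential_form 2 (lift_chart ` A) (ext_deriv 1 (lift_form \<omega>))"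
    by (rule differential_form_ext_deriv_1[OF M' \<omega>'])
  show "form_eq (lift_chart ` A) (ext_deriv 2 (ext_deriv 1 (lift_form \<omega>))) form_zero"
    by (rule ext_deriv_ext_deriv_1[OF M' \<omega>'])
  fix c' y and v :: "nat \<Rightarrow> real^4"
  assume c': "c' \<in> lift_chart ` A" and y: "y \<in> chart_image c'" and v: "v 0 \<noteq> 0"
  then obtain c where c: "c \<in> A" "c' = lift_chart c" by auto
  have x: "prj y \<in> chart_image c" using y c by (simp add: chart_image_lift)
  obtain w where w: "wedge 1 2 \<omega> (ext_deriv 1 \<omega>) c (prj y) w \<noteq> 0"
    using \<omega> c x unfolding contact_form_def nowhere_zero_def by blast
  show "\<exists>u. ext_deriv 1 (lift_form \<omega>) c' y (v(1 := u)) \<noteq> 0"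
  proof (rule ccontr)
    assume "\<not> ?thesis"
    then have "sympl (\<lambda>u. \<omega> c (prj y) (\<lambda>_. u)) (ext_deriv_at \<omega> c (prj y)) (decomp (v 0)) (decomp u) = 0" for u
      using ext_deriv_lift_form[OF M \<omega>1 c(1) x, of "v(1 := u)"] by (simp add: c(2))
    \<comment> \<open>Every pair \<open>z\<close> is \<open>decomp\<close> of some vector, namely of
      its image under \<open>emb\<close>.\<close>
    then have null: "sympl (\<lambda>u. \<omega> c (prj y) (\<lambda>_. u)) (ext_deriv_at \<omega> c (prj y)) (decomp (v 0)) z = 0" for z
      by (metis decomp_emb prod.collapse)
    have "decomp (v 0) = 0"
      by (rule sympl_nondegenerate[OF differential_form_1D(2)[OF \<omega>1 c(1) x]
            ext_deriv_at_alternating[OF M \<omega>1 c(1) x] w[unfolded wedge_1_2_eq[OF M \<omega>1 \<omega>1 c(1) x]] null])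
    with v show False by (simp add: decomp_eq_0_iff)
  qed
qed

text \<open>A linear combination of symplectizations is the symplectization of the combined
  one-form, so a single square formula also covers the mixed products. Numbers \<open>r\<close> and
  \<open>q\<close> suffice for function coefficients, since the wedge product is taken point by
  point.\<close>

lemma wedge_square_lift:
  fixes r q :: real
  assumes M: "smooth_manifold X A" and \<omega>: "differential_form 1 A \<omega>" and \<eta>: "differential_form 1 A \<eta>"
    and c: "c \<in> A" and x: "prj y \<in> chart_image c"
  defines "a \<equiv> \<lambda>u. r * \<omega> c (prj y) (\<lambda>_. u) + q * \<eta> c (prj y) (\<lambda>_. u)"
    and "B \<equiv> \<lambda>u w. r * ext_deriv_at \<omega> c (prj y) u w + q * ext_deriv_at \<eta> c (prj y) u w"
    and "\<theta> \<equiv> \<lambda>v. r * ext_deriv 1 (lift_form \<omega>) (lift_chart c) y v + q * ext_deriv 1 (lift_form \<eta>) (lift_chart c) y v"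
  shows "alt_wedge 2 2 \<theta> \<theta> v = 2 * (exp (y $ 4))\<^sup>2 *
    line_wedge (\<lambda>u v w. a u * B v w - a v * B u w + a w * B u v) (\<lambda>i. decomp (v i))"
proof -
  have \<theta>: "\<theta> = (\<lambda>v. exp (y $ 4) * sympl a B (decomp (v 0)) (decomp (v 1)))"
    unfolding \<theta>_def ext_deriv_lift_form[OF M \<omega> c x] ext_deriv_lift_form[OF M \<eta> c x]
    by (simp add: sympl_def a_def B_def algebra_simps)
  note D = ext_deriv_at_alternating[OF M \<omega> c x] ext_deriv_at_alternating[OF M \<eta> c x]
  have lin: "linear (\<lambda>u. r * f u + q * g u)" if "linear f" "linear g" for f g :: "real^3 \<Rightarrow> real"
    using that by (simp add: linear_iff algebra_simps)
  have "linear (\<lambda>u. B u w)" "linear (B u)" "B u u = 0" for u w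
    unfolding B_def using lin[OF D(1) D(4)] lin[OF D(2) D(5)] D(3,6) by simp_all
  then show ?thesis unfolding \<theta> by (rule sympl_square)
qed

theorem proposition6:
  fixes X :: "'m topology"
    and A :: "('m, real^3) chart set"
    and \<epsilon> :: real
    and \<omega>1 \<omega>2 \<omega>3 \<Omega> :: "('m, real^3) form"
    and C C3 :: "'m \<Rightarrow> real"
  assumes "smooth_manifold X A"
    and "orientable A"
    and "normalized_bi_contact A \<epsilon> \<omega>1 \<omega>2 \<Omega>"
    and "invariant_function A \<omega>1 \<omega>2 \<Omega> C"
    and "differential_form 1 A \<omega>3"
    and "form_eq A (wedge 2 1 (wedge 1 1 \<omega>1 \<omega>2) \<omega>3) \<Omega>"
    and "smooth_fun A C3"
    and "form_eq A (differential C) (form_scale C3 \<omega>3)"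
    and "form_eq A (wedge 2 1 (wedge 1 1 (differential C) \<omega>1) \<omega>2) (form_scale C3 \<Omega>)"
    and "\<forall>p\<in>topspace X. C3 p \<noteq> 0"
    and "form_eq A (wedge 1 1 (differential C3) \<omega>3) form_zero"
  shows "\<exists>(X' :: ('m \<times> real) topology) (A' :: ('m \<times> real, real^4) chart set) \<iota>.
           smooth_manifold X' A' \<and> smooth_embedding X A X' A' \<iota> \<and>
           admits_symplectic_quadratic A'"
proof -
  note M = assms(1)
  have contact: "contact_form A \<omega>1" "contact_form A \<omega>2" and \<epsilon>: "\<epsilon> \<in> {1, - 1}"
    and N1: "form_eq A \<Omega> (wedge 1 2 \<omega>1 (ext_deriv 1 \<omega>1))"
    and N2: "form_eq A \<Omega> (form_scale (\<lambda>_. - \<epsilon>) (wedge 1 2 \<omega>2 (ext_deriv 1 \<omega>2)))"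
    using assms(3) by (auto simp: normalized_bi_contact_def bi_contact_def)
  have C: "smooth_fun A C" and N12: "form_eq A
       (form_add (wedge 1 2 \<omega>1 (ext_deriv 1 \<omega>2)) (wedge 1 2 \<omega>2 (ext_deriv 1 \<omega>1)))
       (form_scale (\<lambda>p. 2 * C p) \<Omega>)"
    using assms(4) by (auto simp: invariant_function_def)
  have \<omega>: "differential_form 1 A \<omega>1" "differential_form 1 A \<omega>2"
    using contact by (simp_all add: contact_form_def)
  define \<theta>1 where "\<theta>1 = ext_deriv 1 (lift_form \<omega>1)"
  define \<theta>2 where "\<theta>2 = ext_deriv 1 (lift_form \<omega>2)"
  define T where "T c x u v w = \<omega>1 c x (\<lambda>_. u) * ext_deriv_at \<omega>1 c x v w - \<omega>1 c x (\<lambda>_. v) * ext_deriv_at \<omega>1 c x u w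
    + \<omega>1 c x (\<lambda>_. w) * ext_deriv_at \<omega>1 c x u v" for c x u v w
  let ?A' = "lift_chart ` A" and ?\<Omega>' = "wedge 2 2 \<theta>1 \<theta>1"
  have square: "alt_wedge 2 2 (\<lambda>v. r * \<theta>1 (lift_chart c) y v + q * \<theta>2 (lift_chart c) y v)
      (\<lambda>v. r * \<theta>1 (lift_chart c) y v + q * \<theta>2 (lift_chart c) y v) v =
    quadratic_poly \<epsilon> (C (chart_inv c (prj y))) r q *
      (2 * (exp (y $ 4))\<^sup>2 * line_wedge (T c (prj y)) (\<lambda>i. decomp (v i)))"
    if c: "c \<in> A" and x: "prj y \<in> chart_image c" for c y r q v
  proof -
    let ?x = "prj y" and ?C = "C (chart_inv c (prj y))"
    define a1 where "a1 u = \<omega>1 c ?x (\<lambda>_. u)" for u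
    define a2 where "a2 u = \<omega>2 c ?x (\<lambda>_. u)" for u
    define B1 where "B1 = ext_deriv_at \<omega>1 c ?x"
    define B2 where "B2 = ext_deriv_at \<omega>2 c ?x"
    note W = wedge_1_2_eq[OF M _ _ c x]
    have rel: "a1 u * B1 v w - a1 v * B1 u w + a1 w * B1 u v
        = - \<epsilon> * (a2 u * B2 v w - a2 v * B2 u w + a2 w * B2 u v)"
      "(a1 u * B2 v w - a1 v * B2 u w + a1 w * B2 u v) + (a2 u * B1 v w - a2 v * B1 u w + a2 w * B1 u v)
        = 2 * ?C * (a1 u * B1 v w - a1 v * B1 u w + a1 w * B1 u v)" for u v w
    proof -
      define z where "z = (\<lambda>i::nat. if i = 0 then u else if i = 1 then v else w)"
      have z: "z 0 = u" "z 1 = v" "z 2 = w" by (auto simp: z_def)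
      have "\<Omega> c ?x z = wedge 1 2 \<omega>1 (ext_deriv 1 \<omega>1) c ?x z"
        "\<Omega> c ?x z = - \<epsilon> * wedge 1 2 \<omega>2 (ext_deriv 1 \<omega>2) c ?x z"
        "wedge 1 2 \<omega>1 (ext_deriv 1 \<omega>2) c ?x z + wedge 1 2 \<omega>2 (ext_deriv 1 \<omega>1) c ?x z = 2 * ?C * \<Omega> c ?x z"
        using N1 N2 N12 c x unfolding form_eq_def form_scale_def form_add_def by blast+
      then have "\<Omega> c ?x z = a1 u * B1 v w - a1 v * B1 u w + a1 w * B1 u v"
        "\<Omega> c ?x z = - \<epsilon> * (a2 u * B2 v w - a2 v * B2 u w + a2 w * B2 u v)"
        "(a1 u * B2 v w - a1 v * B2 u w + a1 w * B2 u v) + (a2 u * B1 v w - a2 v * B1 u w + a2 w * B1 u v)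
          = 2 * ?C * \<Omega> c ?x z"
        unfolding W[OF \<omega>(1,1)] W[OF \<omega>(2,2)] W[OF \<omega>(1,2)] W[OF \<omega>(2,1)] z a1_def B1_def a2_def B2_def .
      then show "a1 u * B1 v w - a1 v * B1 u w + a1 w * B1 u v
        = - \<epsilon> * (a2 u * B2 v w - a2 v * B2 u w + a2 w * B2 u v)"
      "(a1 u * B2 v w - a1 v * B2 u w + a1 w * B2 u v) + (a2 u * B1 v w - a2 v * B1 u w + a2 w * B1 u v)
        = 2 * ?C * (a1 u * B1 v w - a1 v * B1 u w + a1 w * B1 u v)" by simp_all
    qed
    have \<epsilon>2: "\<epsilon> * \<epsilon> = 1" using \<epsilon> by auto
    have "(r * a1 u + q * a2 u) * (r * B1 v w + q * B2 v w) - (r * a1 v + q * a2 v) * (r * B1 u w + q * B2 u w)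
        + (r * a1 w + q * a2 w) * (r * B1 u v + q * B2 u v)
      = quadratic_poly \<epsilon> ?C r q * T c ?x u v w" for u v w
      unfolding quadratic_poly_def T_def a1_def[symmetric] B1_def[symmetric]
      using rel[of u v w] \<epsilon>2 by algebra
    then have eq: "(\<lambda>u v w. (r * a1 u + q * a2 u) * (r * B1 v w + q * B2 v w)
        - (r * a1 v + q * a2 v) * (r * B1 u w + q * B2 u w)
        + (r * a1 w + q * a2 w) * (r * B1 u v + q * B2 u v))
      = (\<lambda>u v w. quadratic_poly \<epsilon> ?C r q * T c ?x u v w)" by simp
    show ?thesis
      unfolding \<theta>1_def \<theta>2_def wedge_square_lift[OF M \<omega> c x]
        a1_def[symmetric] a2_def[symmetric] B1_def[symmetric] B2_def[symmetric] eq line_wedge_scale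
      by simp
  qed
  have \<Omega>'_eq: "?\<Omega>' (lift_chart c) y v = 2 * (exp (y $ 4))\<^sup>2 * line_wedge (T c (prj y)) (\<lambda>i. decomp (v i))"
    if "c \<in> A" "prj y \<in> chart_image c" for c y v
    using square[OF that, of 1 0 v] by (simp add: wedge_def quadratic_poly_def)
  have "differential_form (2 + 2) ?A' ?\<Omega>'"
    unfolding \<theta>1_def
    by (intro differential_form_wedge[OF smooth_manifold_lift[OF M]]
        differential_form_ext_deriv_1[OF smooth_manifold_lift[OF M]] differential_form_lift_form[OF M \<omega>(1)])
  moreover have "nowhere_zero ?A' ?\<Omega>'"
    unfolding nowhere_zero_def
  proof (intro ballI)
    fix c' y assume "c' \<in> ?A'" and y: "y \<in> chart_image c'"
    then obtain c where c: "c \<in> A" "c' = lift_chart c" by auto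
    have x: "prj y \<in> chart_image c" using y c by (simp add: chart_image_lift)
    obtain w where "wedge 1 2 \<omega>1 (ext_deriv 1 \<omega>1) c (prj y) w \<noteq> 0"
      using contact(1) c x unfolding contact_form_def nowhere_zero_def by blast
    then have w: "T c (prj y) (w 0) (w 1) (w 2) \<noteq> 0"
      unfolding T_def wedge_1_2_eq[OF M \<omega>(1,1) c(1) x] .
    \<comment> \<open>The direction of the line followed by a triple on which the contact three-form
      is nonzero, shifted by one index. The last three vectors have no line component, so only the
      first term of \<open>line_wedge\<close> survives.\<close>
    let ?v = "\<lambda>i::nat. if i = 0 then emb 0 1 else emb (w (i - 1)) 0"
    have "?\<Omega>' c' y ?v = 2 * (exp (y $ 4))\<^sup>2 * T c (prj y) (w 0) (w 1) (w 2)"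
      unfolding c(2) \<Omega>'_eq[OF c(1) x] by (simp add: line_wedge_def)
    with w have "?\<Omega>' c' y ?v \<noteq> 0" by simp
    then show "\<exists>v. ?\<Omega>' c' y v \<noteq> 0" by blast
  qed
  ultimately have vol: "volume_form ?A' ?\<Omega>'" by (simp add: volume_form_def)
  have "smooth_on (chart_image (lift_chart c)) (C \<circ> fst \<circ> chart_inv (lift_chart c))" if c: "c \<in> A" for c
    unfolding chart_image_lift
  proof (rule smooth_on_cong)
    show op: "open (prj -` chart_image c)" by (rule open_prj_vimage[OF chart_open[OF M c]])
    show "(C \<circ> chart_inv c) (prj y) = (C \<circ> fst \<circ> chart_inv (lift_chart c)) y" if "y \<in> prj -` chart_image c" for y
      using chart_inv_lift[OF M c, of y] that by simp
    show "smooth_on (prj -` chart_image c) (\<lambda>y. (C \<circ> chart_inv c) (prj y))"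
      using C c unfolding smooth_fun_def smooth_on_def
      by (intro allI Ck_on_linear_compose[OF op bounded_linear_prj, where f = "C \<circ> chart_inv c" and S = "chart_image c"]) auto
  qed
  then have C': "smooth_fun ?A' (C \<circ> fst)" unfolding smooth_fun_def by blast
  have "form_eq ?A' (wedge 2 2 (form_add (form_scale b1 \<theta>1) (form_scale b2 \<theta>2))
        (form_add (form_scale b1 \<theta>1) (form_scale b2 \<theta>2)))
      (form_scale (\<lambda>p. quadratic_poly \<epsilon> ((C \<circ> fst) p) (b1 p) (b2 p)) ?\<Omega>')" for b1 b2
    unfolding form_eq_def
  proof (intro ballI allI)
    fix c' y v assume "c' \<in> ?A'" and y: "y \<in> chart_image c'"
    then obtain c where c: "c \<in> A" "c' = lift_chart c" by auto
    have x: "prj y \<in> chart_image c" using y c by (simp add: chart_image_lift)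
    have "(C \<circ> fst) (chart_inv (lift_chart c) y) = C (chart_inv c (prj y))"
      by (simp add: chart_inv_lift[OF M c(1) x])
    then show "wedge 2 2 (form_add (form_scale b1 \<theta>1) (form_scale b2 \<theta>2))
        (form_add (form_scale b1 \<theta>1) (form_scale b2 \<theta>2)) c' y v =
      form_scale (\<lambda>p. quadratic_poly \<epsilon> ((C \<circ> fst) p) (b1 p) (b2 p)) ?\<Omega>' c' y v"
      \<comment> \<open>The coefficient functions enter only through their values at the point, so
        \<open>square\<close> applies with these values as \<open>r\<close> and
        \<open>q\<close>.\<close>
      unfolding c(2) form_add_def form_scale_def wedge_def square[OF c(1) x]
      using \<Omega>'_eq[OF c(1) x] by (simp add: wedge_def)
  qed
  then have "symplectic_quadratic ?A' \<epsilon> (C \<circ> fst) ?\<Omega>' \<theta>1 \<theta>2"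
    using \<epsilon> C' vol symplectic_form_lift[OF M] contact
    unfolding symplectic_quadratic_def Let_def \<theta>1_def \<theta>2_def by blast
  then have "admits_symplectic_quadratic ?A'" unfolding admits_symplectic_quadratic_def by blast
  with smooth_manifold_lift[OF M] smooth_embedding_zero_section[OF M] show ?thesis by blast
qed

end
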